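(* There exists a function $f:\mathbb{N}\to\mathbb{N}$ such that, for every $n\in\mathbb{N}$, every simple permutation that contains a sum of $f(n)$ copies of $21$ must contain a parallel or wedge sawtooth alternation of length $3n$ or an increasing oscillation of length $n$.
   Context: A permutation $\pi$ of length $n$ is identified with its plot, the set of points $(i,\pi(i))$. Containment is classical pattern containment. An interval of $\pi$ is a nonempty set of points $\{(i,\pi(i)):i\in I\}$ with both $I$ and $\pi(I)$ sets of consecutive integers; $\pi$ is simple if $\pi\neq 1$ and its only intervals are the singletons and the whole of $\pi$. The sum of $k$ copies of 21 is $\oplus_k 21 = 21\,43\,65\cdots(2k)(2k-1)$. A point $(x,y)$ slices a rectangle $[a,b]\times[c,d]$ if either $x\in(a,b)$ and $y\notin[c,d]$, or $x\notin[a,b]$ and $y\in(c,d)$; it slices a set of points if it slices the smallest axes-parallel rectangle $\mathrm{rect}(\cdot)$ containing them. A sawtooth alternation of length $3n$ is a permutation on $3n$ points consisting of a sum of $n$ copies of 21 placed alongside (i.e. entirely above, below, to the left or to the right of) a monotone sequence of $n$ points, such that each copy of 21 is sliced by a single entry of the monotone sequence. It is parallel if the monotone sequence is increasing and wedge if it is decreasing. For example, with the monotone sequence below and $n=4$: parallel is $6,1,5,8,2,7,10,3,9,12,4,11$ and wedge is $6,4,5,8,3,7,10,2,9,12,1,11$. A proper pin sequence is a sequence of points $p_1,p_2,\dots$ of a permutation such that for each $i\ge 3$, $p_i$ slices $\mathrm{rect}(p_1,\dots,p_{i-1})$ (its direction, left/right/up/down, being its position relative to this rectangle), each pin $p_i$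 is the most extreme point in its direction among the points slicing $\mathrm{rect}(p_1,\dots,p_{i-1})$, and each $p_{i+1}$ lies horizontally or vertically between $\mathrm{rect}(p_1,\dots,p_{i-1})$ and $p_i$. An increasing oscillation of length $n$ is a permutation of length $n$ whose points form a proper pin sequence that starts from a copy of 21 (i.e. $p_1,p_2$ form a 21) and all of whose subsequent pins are right and up pins (necessarily alternating); e.g. $2,4,1,6,3,8,5,10,7,12,9,11$. (For length 1 it is the permutation $1$, for length 2 it is $21$; for each length $n\geq 3$ there are two, which are inverses of each other or related by another symmetry of the square.) *)

theory Defs
  imports "HOL-Combinatorics.Multiset_Permutations"
begin

text \<open>
  A permutation of length \<open>m\<close> is given in one-line notation, as a list of natural numbers, and is
  identified with its plot. Positions and values both range over \<open>{1..m}\<close>.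
\<close>

definition is_perm :: "nat list \<Rightarrow> bool" where
  "is_perm \<pi> \<longleftrightarrow> \<pi> \<in> permutations_of_set {1..length \<pi>}"

type_synonym point = "nat \<times> nat"

definition plot :: "nat list \<Rightarrow> point set" where
  "plot \<pi> = {(Suc i, \<pi> ! i) | i. i < length \<pi>}"

definition order_iso :: "(point \<Rightarrow> point) \<Rightarrow> point set \<Rightarrow> point set \<Rightarrow> bool" where
  "order_iso h P Q \<longleftrightarrow> bij_betw h P Q \<and>
     (\<forall>p\<in>P. \<forall>q\<in>P. (fst p < fst q \<longleftrightarrow> fst (h p) < fst (h q)) \<and>
                  (snd p < snd q \<longleftrightarrow> snd (h p) < snd (h q)))"

definition contains :: "nat list \<Rightarrow> nat list \<Rightarrow> bool" where
  "contains \<pi> \<sigma> \<longleftrightarrow> (\<exists>Q h. Q \<subseteq> plot \<pi> \<and> order_iso h (plot \<sigma>) Q)"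

definition consecutive :: "nat set \<Rightarrow> bool" where
  "consecutive S \<longleftrightarrow> (\<exists>a b. S = {a..b})"

text \<open>
  Every subset \<open>P\<close> of the plot has the form \<open>{(i, \<pi>(i)) | i. i \<in> I}\<close> with \<open>I = fst ` P\<close> and
  \<open>\<pi>(I) = snd ` P\<close>.
\<close>

definition perm_interval :: "nat list \<Rightarrow> point set \<Rightarrow> bool" where
  "perm_interval \<pi> P \<longleftrightarrow>
     P \<noteq> {} \<and> P \<subseteq> plot \<pi> \<and> consecutive (fst ` P) \<and> consecutive (snd ` P)"

definition simple :: "nat list \<Rightarrow> bool" where
  "simple \<pi> \<longleftrightarrow> is_perm \<pi> \<and> \<pi> \<noteq> [1] \<and>
     (\<forall>P. perm_interval \<pi> P \<longrightarrow> (\<exists>p. P = {p}) \<or> P = plot \<pi>)"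

definition sum21 :: "nat \<Rightarrow> nat list" where
  "sum21 k = concat (map (\<lambda>i. [2 * i, 2 * i - 1]) [1..<Suc k])"

text \<open>The rectangle \<open>[a,b] \<times> [c,d]\<close> is represented by the quadruple \<open>(a, b, c, d)\<close>.\<close>

type_synonym rectangle = "nat \<times> nat \<times> nat \<times> nat"

definition rect :: "point set \<Rightarrow> rectangle" where
  "rect P = (Min (fst ` P), Max (fst ` P), Min (snd ` P), Max (snd ` P))"

fun slices :: "point \<Rightarrow> rectangle \<Rightarrow> bool" where
  "slices (x, y) (a, b, c, d) \<longleftrightarrow>
     x \<in> {a<..<b} \<and> y \<notin> {c..d} \<or> x \<notin> {a..b} \<and> y \<in> {c<..<d}"

definition alongside :: "point set \<Rightarrow> point set \<Rightarrow> bool" where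
  "alongside M T \<longleftrightarrow>
     (\<forall>z\<in>M. \<forall>t\<in>T. snd t < snd z) \<or> (\<forall>z\<in>M. \<forall>t\<in>T. snd z < snd t) \<or>
     (\<forall>z\<in>M. \<forall>t\<in>T. fst z < fst t) \<or> (\<forall>z\<in>M. \<forall>t\<in>T. fst t < fst z)"

definition increasing_points :: "point set \<Rightarrow> bool" where
  "increasing_points M \<longleftrightarrow> (\<forall>p\<in>M. \<forall>q\<in>M. fst p < fst q \<longrightarrow> snd p < snd q)"

definition decreasing_points :: "point set \<Rightarrow> bool" where
  "decreasing_points M \<longleftrightarrow> (\<forall>p\<in>M. \<forall>q\<in>M. fst p < fst q \<longrightarrow> snd q < snd p)"

text \<open>
  The points of \<open>\<sigma>\<close> split into \<open>T\<close>, a sum of \<open>n\<close> copies of 21, and \<open>M\<close>, whose monotonicity is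
  imposed separately below. The \<open>i\<close>-th copy of 21 in \<open>T\<close> is the image under \<open>h\<close> of the \<open>i\<close>-th copy
  in \<open>sum21 n\<close>.
\<close>

definition sawtooth_parts :: "nat \<Rightarrow> nat list \<Rightarrow> point set \<Rightarrow> point set \<Rightarrow> bool" where
  "sawtooth_parts n \<sigma> T M \<longleftrightarrow>
     is_perm \<sigma> \<and> length \<sigma> = 3 * n \<and>
     plot \<sigma> = T \<union> M \<and> T \<inter> M = {} \<and> card M = n \<and> alongside M T \<and>
     (\<exists>h. order_iso h (plot (sum21 n)) T \<and>
          (\<forall>i\<in>{1..n}. \<exists>!z. z \<in> M \<and>
             slices z (rect (h ` {(2 * i - 1, 2 * i), (2 * i, 2 * i - 1)}))))"

definition parallel_sawtooth :: "nat \<Rightarrow> nat list \<Rightarrow> bool" where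
  "parallel_sawtooth n \<sigma> \<longleftrightarrow> (\<exists>T M. sawtooth_parts n \<sigma> T M \<and> increasing_points M)"

definition wedge_sawtooth :: "nat \<Rightarrow> nat list \<Rightarrow> bool" where
  "wedge_sawtooth n \<sigma> \<longleftrightarrow> (\<exists>T M. sawtooth_parts n \<sigma> T M \<and> decreasing_points M)"

datatype direction = West | East | North | South

fun lies :: "direction \<Rightarrow> point \<Rightarrow> rectangle \<Rightarrow> bool" where
  "lies West (x, y) (a, b, c, d) \<longleftrightarrow> x < a"
| "lies East (x, y) (a, b, c, d) \<longleftrightarrow> b < x"
| "lies South (x, y) (a, b, c, d) \<longleftrightarrow> y < c"
| "lies North (x, y) (a, b, c, d) \<longleftrightarrow> d < y"

fun at_least_as_extreme :: "direction \<Rightarrow> point \<Rightarrow> point \<Rightarrow> bool" where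
  "at_least_as_extreme West (x, y) (u, v) \<longleftrightarrow> x \<le> u"
| "at_least_as_extreme East (x, y) (u, v) \<longleftrightarrow> u \<le> x"
| "at_least_as_extreme South (x, y) (u, v) \<longleftrightarrow> y \<le> v"
| "at_least_as_extreme North (x, y) (u, v) \<longleftrightarrow> v \<le> y"

fun between :: "point \<Rightarrow> rectangle \<Rightarrow> point \<Rightarrow> bool" where
  "between (u, v) (a, b, c, d) (x, y) \<longleftrightarrow>
     (b < u \<and> u < x \<or> x < u \<and> u < a) \<or> (d < v \<and> v < y \<or> y < v \<and> v < c)"

text \<open>
  Pin sequences are finite lists indexed from 0, so that \<open>ps ! i\<close> is the pin \<open>p\<^sub>i\<^sub>+\<^sub>1\<close> and
  \<open>set (take i ps)\<close> is \<open>{p\<^sub>1, \<dots>, p\<^sub>i}\<close>. A point slicing a rectangle lies in exactly one direction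
  from it, which is the direction of the pin.
\<close>

definition proper_pin_sequence :: "nat list \<Rightarrow> point list \<Rightarrow> bool" where
  "proper_pin_sequence \<pi> ps \<longleftrightarrow> set ps \<subseteq> plot \<pi> \<and>
     (\<forall>i. 2 \<le> i \<and> i < length ps \<longrightarrow>
        slices (ps ! i) (rect (set (take i ps))) \<and>
        (\<forall>D. lies D (ps ! i) (rect (set (take i ps))) \<longrightarrow>
           (\<forall>z\<in>plot \<pi>. slices z (rect (set (take i ps))) \<longrightarrow>
              at_least_as_extreme D (ps ! i) z)) \<and>
        between (ps ! i) (rect (set (take (i - 1) ps))) (ps ! (i - 1)))"

text \<open>
  The permutation 1 is an increasing oscillation by convention, having no copy of 21 to start from.
\<close>

definition increasing_oscillation :: "nat list \<Rightarrow> bool" where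
  "increasing_oscillation \<pi> \<longleftrightarrow> \<pi> = [1] \<or>
     is_perm \<pi> \<and>
     (\<exists>ps. 2 \<le> length ps \<and> set ps = plot \<pi> \<and> proper_pin_sequence \<pi> ps \<and>
        (\<exists>h. order_iso h (plot [2, 1]) {ps ! 0, ps ! 1}) \<and>
        (\<forall>i. 2 \<le> i \<and> i < length ps \<longrightarrow>
           lies East (ps ! i) (rect (set (take i ps))) \<or>
           lies North (ps ! i) (rect (set (take i ps)))))"

end

theory Submission
  imports Defs "HOL-Library.Ramsey"
begin

text \<open>
  Two points are \<^emph>\<open>inverted\<close> if they form a 21, and a set is \<^emph>\<open>linked\<close> if its inversion graph is
  connected (sum indecomposable). Let \<open>C\<^sub>0, \<dots>, C\<^sub>M\<close> be a sum of copies of 21 in a simple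
  permutation and let \<open>D\<close> be a maximal linked set around the middle copy that stays strictly between
  \<open>C\<^sub>2\<close> and \<open>C\<^bsub>M-2\<^esub>\<close>. Simplicity provides a point \<open>z\<close> slicing \<open>D\<close>. Adding a slicing point to a linked
  set leaves it linked, so \<open>z\<close> lies outside the box, say above; moreover \<open>z\<close> slices some 21 of \<open>D\<close>.
  Either \<open>z\<close> lies above \<open>C\<^bsub>M-1\<^esub>\<close>, or \<open>D \<union> {z}\<close> is a linked set inside the whole chain that reaches
  from the middle up to \<open>C\<^bsub>M-2\<^esub>\<close>. In the latter case a greedy pin sequence in \<open>D \<union> {z}\<close>, which moves
  alternately right and up, is an increasing oscillation; it has length at least \<open>n\<close> unless one
  of its pins jumps over a whole interval from \<open>C\<^sub>j\<close> to \<open>C\<^bsub>j+1\<^esub>\<close>.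

  By Ramsey's theorem for \<open>(M+1)\<close>-sets, a long chain has a long subchain all of whose subchains of
  length \<open>M+1\<close> have the same outcome. If it is a jump, then jumps in suitably interleaved
  subchains, alternating with points of the chain, form an increasing oscillation of any length.
  Otherwise consecutive blocks of the chain contain copies of 21 sliced by points that lie above
  all of them (or in one of the three other directions), and a monotone subsequence of the
  slicing points gives a sawtooth alternation.
\<close>

section \<open>Inversion graphs and greedy pin sequences\<close>

text \<open>The coordinates are parameters with integer values so that reflection in the diagonal
  (exchanging \<open>X\<close> and \<open>Y\<close>) and the half turn (negating both) are mere
  instantiations. Both preserve inversions.\<close>

definition inverted :: "('p \<Rightarrow> int) \<Rightarrow> ('p \<Rightarrow> int) \<Rightarrow> 'p \<Rightarrow> 'p \<Rightarrow> bool" where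
  "inverted X Y p q \<longleftrightarrow> X p < X q \<and> Y q < Y p \<or> X q < X p \<and> Y p < Y q"

text \<open>Connectedness is encoded by cuts instead of paths, since each argument that uses it
  looks at one cut: at the abscissa of a slicing point or of the last pin.\<close>

definition linked :: "('p \<Rightarrow> int) \<Rightarrow> ('p \<Rightarrow> int) \<Rightarrow> 'p set \<Rightarrow> bool" where
  "linked X Y D \<longleftrightarrow> (\<forall>L\<subseteq>D. L \<noteq> {} \<longrightarrow> L \<noteq> D \<longrightarrow> (\<exists>l\<in>L. \<exists>r\<in>D - L. inverted X Y l r))"

definition before :: "('p \<Rightarrow> int) \<Rightarrow> 'p \<Rightarrow> 'p set \<Rightarrow> bool" where
  "before X p S \<longleftrightarrow> (\<forall>c\<in>S. X p < X c)"

definition after :: "('p \<Rightarrow> int) \<Rightarrow> 'p \<Rightarrow> 'p set \<Rightarrow> bool" where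
  "after X p S \<longleftrightarrow> (\<forall>c\<in>S. X c < X p)"

definition inside :: "('p \<Rightarrow> int) \<Rightarrow> ('p \<Rightarrow> int) \<Rightarrow> 'p set \<Rightarrow> 'p set \<Rightarrow> 'p \<Rightarrow> bool" where
  "inside X Y A B p \<longleftrightarrow> after X p A \<and> after Y p A \<and> before X p B \<and> before Y p B"

text \<open>The bound is inclusive, so there are \<open>M + 1\<close> copies; values of
  \<open>C\<close> beyond \<open>M\<close> are arbitrary.\<close>

definition chain :: "('p \<Rightarrow> int) \<Rightarrow> ('p \<Rightarrow> int) \<Rightarrow> (nat \<Rightarrow> 'p set) \<Rightarrow> nat \<Rightarrow> bool" where
  "chain X Y C M \<longleftrightarrow> (\<forall>i\<le>M. \<exists>a b. C i = {a, b} \<and> inverted X Y a b) \<and>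
     (\<forall>i j. i < j \<longrightarrow> j \<le> M \<longrightarrow> (\<forall>c\<in>C i. \<forall>d\<in>C j. X c < X d \<and> Y c < Y d))"

text \<open>An increasing oscillation in the guise of its inversion graph, a path. This form is
  stable under both symmetries; the pins are recovered in
  \<open>increasing_oscillation_intro\<close>.\<close>

definition has_osc :: "('p \<Rightarrow> int) \<Rightarrow> ('p \<Rightarrow> int) \<Rightarrow> 'p set \<Rightarrow> nat \<Rightarrow> bool" where
  "has_osc X Y P n \<longleftrightarrow> (\<exists>q. (\<forall>i<n. q i \<in> P) \<and>
     (\<forall>i j. i + 2 \<le> j \<longrightarrow> j < n \<longrightarrow> X (q i) < X (q j) \<and> Y (q i) < Y (q j)) \<and>
     (\<forall>i. Suc i < n \<longrightarrow> inverted X Y (q i) (q (Suc i))))"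

text \<open>The point passes the gap between two consecutive copies on the upper left; exchanged
  coordinates give the lower right. The outer copies confine it when jumps of several subchains are
  combined.\<close>

definition jump :: "('p \<Rightarrow> int) \<Rightarrow> ('p \<Rightarrow> int) \<Rightarrow> 'p set \<Rightarrow> (nat \<Rightarrow> 'p set) \<Rightarrow> nat \<Rightarrow> nat \<Rightarrow> bool" where
  "jump X Y P C M j \<longleftrightarrow> (\<exists>p\<in>P. inside X Y (C 0) (C M) p \<and> before X p (C j) \<and> after Y p (C (Suc j)))"

text \<open>The inversion is bounded by index \<open>M - 2\<close> and the slicing point by
  \<open>M - 1\<close>, so that in a homogeneous chain the last two copies can be moved far up
  without affecting the inversion.\<close>

definition saw :: "('p \<Rightarrow> int) \<Rightarrow> ('p \<Rightarrow> int) \<Rightarrow> 'p set \<Rightarrow> (nat \<Rightarrow> 'p set) \<Rightarrow> nat \<Rightarrow> bool" where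
  "saw X Y P C M \<longleftrightarrow> (\<exists>l\<in>P. \<exists>r\<in>P. \<exists>z\<in>P.
     inside X Y (C 0) (C (M - 2)) l \<and> inside X Y (C 0) (C (M - 2)) r \<and>
     X l < X z \<and> X z < X r \<and> Y r < Y l \<and> after Y z (C (M - 1)))"

text \<open>Slicing from above; the other three sides arise by exchanging or negating the
  coordinates.\<close>

definition caps :: "('p \<Rightarrow> int) \<Rightarrow> ('p \<Rightarrow> int) \<Rightarrow> 'p set \<Rightarrow> 'p \<Rightarrow> bool" where
  "caps X Y D z \<longleftrightarrow> (\<exists>d\<in>D. X d < X z) \<and> (\<exists>d\<in>D. X z < X d) \<and> (\<forall>d\<in>D. Y d < Y z)"

lemma inverted_swap: "inverted Y X p q = inverted X Y p q"
  unfolding inverted_def by auto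

lemma inverted_neg: "inverted (\<lambda>p. - X p) (\<lambda>p. - Y p) p q = inverted X Y p q"
  unfolding inverted_def by auto

lemma inverted_commute: "inverted X Y p q = inverted X Y q p"
  unfolding inverted_def by auto

lemma linked_swap: "linked Y X D = linked X Y D"
  unfolding linked_def by (simp add: inverted_swap[of Y X])

lemma linked_neg: "linked (\<lambda>p. - X p) (\<lambda>p. - Y p) D = linked X Y D"
  unfolding linked_def by (simp add: inverted_neg)

lemma before_neg: "before (\<lambda>p. - X p) p S = after X p S"
  unfolding before_def after_def by simp

lemma after_neg: "after (\<lambda>p. - X p) p S = before X p S"
  unfolding before_def after_def by simp

lemma inside_swap: "inside Y X A B p = inside X Y A B p"
  unfolding inside_def by auto

lemma inside_neg: "inside (\<lambda>p. - X p) (\<lambda>p. - Y p) A B p = inside X Y B A p"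
  unfolding inside_def before_neg after_neg by auto

lemma chain_swap: "chain X Y C M \<Longrightarrow> chain Y X C M"
  unfolding chain_def inverted_swap[of Y X] by blast

lemma chain_neg:
  assumes "chain X Y C M"
  shows "chain (\<lambda>p. - X p) (\<lambda>p. - Y p) (\<lambda>i. C (M - i)) M"
proof -
  have "- X c < - X d \<and> - Y c < - Y d"
    if "i < j" "j \<le> M" "c \<in> C (M - i)" "d \<in> C (M - j)" for i j c d
  proof -
    have "M - j < M - i" "M - i \<le> M" using that(1,2) by auto
    then show ?thesis using assms that(3,4) unfolding chain_def by auto
  qed
  then show ?thesis using assms unfolding chain_def inverted_neg by auto
qed

lemma chain_less:
  assumes "chain X Y C M" "c \<in> C i" "d \<in> C j" "i < j" "j \<le> M"
  shows "X c < X d" "Y c < Y d"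
  using assms unfolding chain_def by blast+

lemma chain_nonempty:
  assumes "chain X Y C M" "i \<le> M"
  obtains c where "c \<in> C i"
  using assms unfolding chain_def by blast

lemma has_osc_swap: "has_osc Y X P n \<Longrightarrow> has_osc X Y P n"
  unfolding has_osc_def inverted_swap[of Y X] by blast

lemma has_osc_neg:
  assumes "has_osc (\<lambda>p. - X p) (\<lambda>p. - Y p) P n"
  shows "has_osc X Y P n"
proof -
  obtain q where q: "\<And>i. i < n \<Longrightarrow> q i \<in> P"
    "\<And>i j. i + 2 \<le> j \<Longrightarrow> j < n \<Longrightarrow> X (q j) < X (q i) \<and> Y (q j) < Y (q i)"
    "\<And>i. Suc i < n \<Longrightarrow> inverted X Y (q i) (q (Suc i))"
    using assms unfolding has_osc_def inverted_neg by auto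
  define q' where "q' i = q (n - Suc i)" for i
  have "inverted X Y (q' i) (q' (Suc i))" if "Suc i < n" for i
  proof -
    have "n - Suc i = Suc (n - Suc (Suc i))" using that by simp
    then show ?thesis
      using q(3)[of "n - Suc (Suc i)"] that unfolding q'_def by (simp add: inverted_commute)
  qed
  moreover have "X (q' i) < X (q' j) \<and> Y (q' i) < Y (q' j)" if "i + 2 \<le> j" "j < n" for i j
    using that unfolding q'_def by (intro q(2)) auto
  moreover have "q' i \<in> P" if "i < n" for i using that q(1) unfolding q'_def by simp
  ultimately show ?thesis unfolding has_osc_def by blast
qed

text \<open>The half turn takes upper left to lower right, hence the exchanged coordinates, and
  reverses the chain, so the gap after index \<open>j\<close> becomes the gap after
  \<open>M - Suc j\<close>.\<close>

lemma jump_neg: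
  assumes "jump (\<lambda>p. - X p) (\<lambda>p. - Y p) P (\<lambda>i. C (M - i)) M j" "Suc j \<le> M"
  shows "jump Y X P C M (M - Suc j)"
proof -
  have "Suc (M - Suc j) = M - j" using assms(2) by simp
  then show ?thesis
    using assms unfolding jump_def inside_neg before_neg after_neg by (auto simp: inside_swap)
qed

section \<open>Linked sets and points slicing them\<close>

lemma linked_pair: "inverted X Y a b \<Longrightarrow> linked X Y {a, b}"
  unfolding linked_def
proof (intro allI impI)
  fix L assume ab: "inverted X Y a b" and L: "L \<subseteq> {a, b}" "L \<noteq> {}" "L \<noteq> {a, b}"
  then consider "L = {a}" "b \<noteq> a" | "L = {b}" "b \<noteq> a" by auto
  then show "\<exists>l\<in>L. \<exists>r\<in>{a, b} - L. inverted X Y l r"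
    by cases (use ab inverted_commute[of X Y a b] in auto)
qed

lemma caps_inverted: "caps X Y D z \<Longrightarrow> \<exists>d\<in>D. inverted X Y d z"
  unfolding caps_def inverted_def by blast

text \<open>A cut of the enlarged set either cuts \<open>D\<close>, or separates \<open>z\<close>
  from all of \<open>D\<close> and is then crossed by the inversion of \<open>d\<close> and
  \<open>z\<close>.\<close>

lemma linked_insert:
  assumes D: "linked X Y D" and d: "d \<in> D" "inverted X Y d z"
  shows "linked X Y (insert z D)"
  unfolding linked_def
proof (intro allI impI)
  fix L assume L: "L \<subseteq> insert z D" "L \<noteq> {}" "L \<noteq> insert z D"
  show "\<exists>l\<in>L. \<exists>r\<in>insert z D - L. inverted X Y l r"
  proof (cases "L \<inter> D = {} \<or> L \<inter> D = D")
    case True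
    then show ?thesis
    proof
      assume "L \<inter> D = {}"
      then have "L = {z}" "d \<notin> L" using L d(1) by auto
      then show ?thesis using d inverted_commute by fastforce
    next
      assume "L \<inter> D = D"
      then have "z \<notin> L" "d \<in> L" using L d(1) by auto
      then show ?thesis using d by blast
    qed
  next
    case False
    then obtain l r where "l \<in> L \<inter> D" "r \<in> D - L \<inter> D" "inverted X Y l r"
      using D unfolding linked_def by (metis inf_le2)
    then show ?thesis by blast
  qed
qed

text \<open>Cut \<open>D\<close> at the abscissa of \<open>z\<close>. An inversion across this cut
  has its upper point on the left, and \<open>z\<close> lies between its two abscissae.\<close>

lemma caps_slices_inversion:
  assumes D: "linked X Y D" and z: "caps X Y D z" and inj: "inj_on X (insert z D)"
  shows "\<exists>l\<in>D. \<exists>r\<in>D. X l < X z \<and> X z < X r \<and> Y r < Y l"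
proof -
  define L where "L = {d \<in> D. X d < X z}"
  have "L \<subseteq> D" "L \<noteq> {}" "L \<noteq> D"
    using z unfolding caps_def L_def by (auto, metis (mono_tags, lifting) mem_Collect_eq not_less_iff_gr_or_eq)
  then obtain l r where lr: "l \<in> L" "r \<in> D - L" "inverted X Y l r"
    using D unfolding linked_def by blast
  have "r \<noteq> z" using z lr unfolding caps_def by auto
  then have "X z \<noteq> X r" using inj lr(2) unfolding inj_on_def by auto
  then show ?thesis using lr unfolding L_def inverted_def by (intro bexI[of _ l] bexI[of _ r]) auto
qed

section \<open>Greedy pin sequences in a linked set\<close>

lemma ex_argmax:
  fixes f :: "'p \<Rightarrow> int"
  assumes "finite A" "A \<noteq> {}"
  obtains m where "m \<in> A" "\<And>a. a \<in> A \<Longrightarrow> f a \<le> f m"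
proof -
  have "Max (f ` A) \<in> f ` A" using assms by simp
  then obtain m where "m \<in> A" "f m = Max (f ` A)" by auto
  then show ?thesis using that assms(1) Max_ge by (metis finite_imageI imageI)
qed

text \<open>The state of the greedy construction after the \<open>i\<close>-th pin: \<open>q i\<close> is the rightmost point of
  height at most \<open>\<eta>\<close>, and \<open>\<eta>\<close> bounds the height of all points up to abscissa \<open>\<xi>\<close>. The two
  coordinates exchange their roles after every pin.\<close>

definition greedy :: "('p \<Rightarrow> int) \<Rightarrow> ('p \<Rightarrow> int) \<Rightarrow> 'p set \<Rightarrow> 'p set \<Rightarrow> nat \<Rightarrow>
    (nat \<Rightarrow> 'p) \<Rightarrow> int \<Rightarrow> int \<Rightarrow> bool" where
  "greedy X Y D B i q \<xi> \<eta> \<longleftrightarrow>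
     (\<forall>k\<le>i. q k \<in> D) \<and>
     (\<forall>j k. j + 2 \<le> k \<longrightarrow> k \<le> i \<longrightarrow> X (q j) < X (q k) \<and> Y (q j) < Y (q k)) \<and>
     (\<forall>k. Suc k \<le> i \<longrightarrow> inverted X Y (q k) (q (Suc k))) \<and>
     (\<forall>k<i. X (q k) \<le> \<xi>) \<and>
     (\<forall>p\<in>D. X p \<le> \<xi> \<longrightarrow> Y p \<le> \<eta>) \<and>
     (\<forall>k\<le>i. Y (q k) \<le> \<eta>) \<and>
     (\<forall>p\<in>D. Y p \<le> \<eta> \<longrightarrow> X p \<le> X (q i)) \<and>
     \<xi> \<le> X (q i) \<and>
     before X (q i) B \<and> (\<forall>c\<in>B. \<eta> < Y c)"

text \<open>Without a jump at \<open>s\<close>, the point is no higher than some point of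
  \<open>C (Suc s)\<close>, hence below the next copy. Passing from one coordinate to the other thus
  costs two copies.\<close>

lemma no_jump_bound:
  assumes ch: "chain X Y C M" and p: "p \<in> P" "inside X Y (C 0) (C M) p" "before X p (C s)"
    and nj: "\<not> jump X Y P C M s" and s: "s + 2 \<le> M"
  shows "before Y p (C (s + 2))"
proof -
  obtain c where c: "c \<in> C (Suc s)" "Y p \<le> Y c"
    using nj p unfolding jump_def after_def by fastforce
  show ?thesis unfolding before_def
  proof
    fix d assume "d \<in> C (s + 2)"
    then have "Y c < Y d" using chain_less(2)[OF ch c(1)] s by simp
    then show "Y p < Y d" using c(2) by simp
  qed
qed

text \<open>The next pin is the highest point \<open>u\<close> among those up to the abscissa of
  \<open>q i\<close>. If none of these were higher than \<open>\<eta>\<close>, no inversion would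
  lead from them to the rest of \<open>D\<close>, so they would be all of \<open>D\<close>, which
  \<open>w\<close> excludes.\<close>

lemma greedy_step:
  assumes ch: "chain X Y C M" and D: "linked X Y D" "finite D" "D \<subseteq> P"
    and box: "\<And>d. d \<in> D \<Longrightarrow> inside X Y (C 0) (C M) d"
    and w: "w \<in> D" "\<not> (before X w (C s) \<and> before Y w (C s))"
    and nj: "\<not> jump X Y P C M s" and s: "s + 2 \<le> M"
    and inj: "inj_on X D"
    and G: "greedy X Y D (C s) i q \<xi> \<eta>"
  obtains q' \<xi>' \<eta>' where "greedy Y X D (C (s + 2)) (Suc i) q' \<xi>' \<eta>'"
proof -
  have q: "\<And>k. k \<le> i \<Longrightarrow> q k \<in> D"
      "\<And>j k. j + 2 \<le> k \<Longrightarrow> k \<le> i \<Longrightarrow> X (q j) < X (q k) \<and> Y (q j) < Y (q k)"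
      "\<And>k. Suc k \<le> i \<Longrightarrow> inverted X Y (q k) (q (Suc k))"
    and b: "\<And>k. k < i \<Longrightarrow> X (q k) \<le> \<xi>"
      "\<And>p. p \<in> D \<Longrightarrow> X p \<le> \<xi> \<Longrightarrow> Y p \<le> \<eta>"
      "\<And>k. k \<le> i \<Longrightarrow> Y (q k) \<le> \<eta>"
      "\<And>p. p \<in> D \<Longrightarrow> Y p \<le> \<eta> \<Longrightarrow> X p \<le> X (q i)"
      "\<xi> \<le> X (q i)" "before X (q i) (C s)" "\<And>c. c \<in> C s \<Longrightarrow> \<eta> < Y c"
    using G unfolding greedy_def by simp_all
  define L where "L = {p \<in> D. X p \<le> X (q i)}"
  have qL: "q i \<in> L" using q(1) unfolding L_def by simp
  have "\<exists>p\<in>L. \<eta> < Y p"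
  proof (rule ccontr)
    assume "\<not> (\<exists>p\<in>L. \<eta> < Y p)"
    then have low: "Y p \<le> \<eta>" if "p \<in> L" for p using that by fastforce
    have "\<not> inverted X Y l r" if "l \<in> L" "r \<in> D - L" for l r
    proof -
      have "\<not> Y r \<le> \<eta>" using b(4)[of r] that unfolding L_def by auto
      then show ?thesis using low[OF that(1)] that unfolding L_def inverted_def by auto
    qed
    moreover have "L \<subseteq> D" "L \<noteq> {}" using qL unfolding L_def by auto
    ultimately have "L = D" using D(1) unfolding linked_def by metis
    then have "X w \<le> X (q i)" "Y w \<le> \<eta>" using w(1) low unfolding L_def by auto
    then show False using w(2) b(6,7) unfolding before_def by (meson le_less_trans)
  qed
  then obtain p where p: "p \<in> L" "\<eta> < Y p" by blast
  have "finite L" using D(2) unfolding L_def by simp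
  then obtain u where u: "u \<in> L" "\<And>a. a \<in> L \<Longrightarrow> Y a \<le> Y u"
    using ex_argmax[of L Y] qL by blast
  have uD: "u \<in> D" "X u \<le> X (q i)" using u(1) unfolding L_def by auto
  have uY: "\<eta> < Y u" using u(2)[OF p(1)] p(2) by simp
  \<comment> \<open>Points up to abscissa \<open>\<xi>\<close> have height at most
    \<open>\<eta>\<close>. Being beyond both thresholds puts \<open>u\<close> to the upper right of
    all pins before \<open>q i\<close>.\<close>
  have uX: "\<xi> < X u" using b(2)[OF uD(1)] uY by fastforce
  have "u \<noteq> q i" using uY b(3)[of i] by auto
  then have uXi: "X u < X (q i)"
    using uD inj q(1)[of i] unfolding inj_on_def by (metis order_le_less order_refl)
  define q' where "q' = q(Suc i := u)"
  have q'_old: "q' k = q k" if "k \<le> i" for k using that unfolding q'_def by simp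
  have q'_new: "q' (Suc i) = u" unfolding q'_def by simp
  have beforeu: "before X u (C s)" using uD(2) b(6) unfolding before_def by fastforce
  have "before Y u (C (s + 2))"
    using no_jump_bound[OF ch _ _ beforeu nj s] uD(1) D(3) box by blast
  moreover have "X (q i) < X c" if "c \<in> C (s + 2)" for c
  proof -
    obtain d where d: "d \<in> C s" using chain_nonempty[OF ch, of s] s by auto
    then have "X d < X c" using chain_less(1)[OF ch d that] s by simp
    then show ?thesis using b(6) d unfolding before_def by fastforce
  qed
  moreover have "q' k \<in> D" if "k \<le> Suc i" for k
    using that q(1) uD(1) unfolding q'_def by auto
  moreover have "Y (q' j) < Y (q' k) \<and> X (q' j) < X (q' k)" if jk: "j + 2 \<le> k" "k \<le> Suc i" for j k
  proof (cases "k = Suc i")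
    case True
    then have "Y (q j) \<le> \<eta>" "X (q j) \<le> \<xi>" using b(1,3) jk by auto
    then show ?thesis using uX uY True q'_new q'_old[of j] jk by auto
  next
    case False
    then show ?thesis using q(2) jk q'_old[of j] q'_old[of k] by auto
  qed
  moreover have "inverted Y X (q' k) (q' (Suc k))" if "Suc k \<le> Suc i" for k
  proof (cases "k = i")
    case True
    have "Y (q i) < Y u" using b(3)[of i] uY by simp
    then show ?thesis using True q'_new q'_old[of i] uXi unfolding inverted_def by auto
  next
    case False
    then show ?thesis using q(3) that q'_old[of k] q'_old[of "Suc k"] by (auto simp: inverted_swap)
  qed
  moreover have "Y (q' k) \<le> \<eta>" if "k < Suc i" for k
    using that b(3) q'_old by simp
  moreover have "X (q' k) \<le> X (q i)" if k: "k \<le> Suc i" for k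
  proof -
    consider "k < i" | "k = i" | "k = Suc i" using k by linarith
    then show ?thesis
      by cases (use b(1)[of k] b(5) uXi q'_old[of k] q'_new in auto)
  qed
  moreover have "Y p \<le> Y (q' (Suc i))" if "p \<in> D" "X p \<le> X (q i)" for p
    using that u(2) unfolding q'_new L_def by simp
  moreover have "\<eta> \<le> Y (q' (Suc i))" using uY q'_new by simp
  \<comment> \<open>As the axes exchange roles, the old \<open>\<eta>\<close> becomes the new
    \<open>\<xi>\<close>, and the abscissa of \<open>q i\<close> becomes the new
    \<open>\<eta>\<close>.\<close>
  ultimately have "greedy Y X D (C (s + 2)) (Suc i) q' \<eta> (X (q i))"
    unfolding greedy_def using b(4) q'_new by simp
  then show ?thesis by (rule that)
qed

lemma greedy_has_osc:
  assumes "greedy X Y D B i q \<xi> \<eta>" "D \<subseteq> P"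
  shows "has_osc X Y P (Suc i)"
  using assms unfolding has_osc_def greedy_def by (intro exI[of _ q]) auto

text \<open>The first pin takes two maximizations: \<open>v\<close> is the highest point up to the
  abscissa of \<open>a\<close>, and \<open>u\<close> the rightmost point up to the height of
  \<open>v\<close>. The bound moves from \<open>c + 1\<close> to \<open>c + 3\<close> for
  \<open>v\<close> and to \<open>c + 5\<close> for \<open>u\<close>.\<close>

lemma greedy_start:
  assumes ch: "chain X Y C M" and D: "finite D" "D \<subseteq> P"
    and box: "\<And>d. d \<in> D \<Longrightarrow> inside X Y (C 0) (C M) d"
    and a: "a \<in> D" "a \<in> C c"
    and nj: "\<And>j. Suc j < M \<Longrightarrow> \<not> jump X Y P C M j" "\<And>j. Suc j < M \<Longrightarrow> \<not> jump Y X P C M j"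
    and c: "c + 5 \<le> M"
  obtains q \<xi> \<eta> where "greedy X Y D (C (c + 5)) 0 q \<xi> \<eta>"
proof -
  have lt: "X c' < X d \<and> Y c' < Y d" if "c' \<in> C i" "d \<in> C j" "i < j" "j \<le> M" for c' d i j
    using ch that unfolding chain_def by blast
  define A where "A = {p \<in> D. X p \<le> X a}"
  have "finite A" "a \<in> A" using D(1) a(1) unfolding A_def by auto
  then obtain v where v: "v \<in> A" "\<And>p. p \<in> A \<Longrightarrow> Y p \<le> Y v"
    using ex_argmax[of A Y] by blast
  define B where "B = {p \<in> D. Y p \<le> Y v}"
  have "finite B" "a \<in> B" using D(1) a(1) v(2)[OF \<open>a \<in> A\<close>] unfolding B_def by auto
  then obtain u where u: "u \<in> B" "\<And>p. p \<in> B \<Longrightarrow> X p \<le> X u"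
    using ex_argmax[of B X] by blast
  have vD: "v \<in> D" "X v \<le> X a" using v(1) unfolding A_def by auto
  have uD: "u \<in> D" "Y u \<le> Y v" using u(1) unfolding B_def by auto
  have "before X v (C (c + 1))" unfolding before_def
    using lt[OF a(2), of _ "c + 1"] c vD(2) by fastforce
  then have v3: "before Y v (C (c + 3))"
    using no_jump_bound[OF ch, of v P "c + 1"] nj(1)[of "c + 1"] c D(2) vD(1) box
    by (auto simp: numeral_eq_Suc)
  then have "before Y u (C (c + 3))" using uD(2) unfolding before_def by fastforce
  then have u5: "before X u (C (c + 5))"
    using no_jump_bound[OF chain_swap[OF ch], of u P "c + 3"] nj(2)[of "c + 3"] c D(2) uD(1) box
    by (auto simp: numeral_eq_Suc inside_swap)
  have v5: "Y v < Y d" if "d \<in> C (c + 5)" for d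
  proof -
    obtain e where "e \<in> C (c + 3)" using chain_nonempty[OF ch, of "c + 3"] c by auto
    then show ?thesis using v3 lt[of e "c + 3" d "c + 5"] that c unfolding before_def by fastforce
  qed
  have "greedy X Y D (C (c + 5)) 0 (\<lambda>_. u) (X a) (Y v)"
    unfolding greedy_def using uD u(2) v(2) v5 u5 \<open>a \<in> B\<close> by (auto simp: A_def B_def)
  then show ?thesis by (rule that)
qed

text \<open>Without jumps the greedy construction continues as long as its bound is at most
  \<open>C b\<close>, because \<open>w\<close> is not to the lower left of that copy. It starts at
  \<open>c + 5\<close> and spends two copies per step, so there is room for \<open>n\<close>
  steps.\<close>

lemma linked_osc_or_jump:
  assumes ch: "chain X Y C M" and D: "linked X Y D" "finite D" "D \<subseteq> P"
    and box: "\<And>d. d \<in> D \<Longrightarrow> inside X Y (C 0) (C M) d"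
    and a: "a \<in> D" "a \<in> C c"
    and w: "w \<in> D" "\<not> (before X w (C b) \<and> before Y w (C b))"
    and b: "c + 5 + 2 * n \<le> b" "b + 2 \<le> M"
    and inj: "inj_on X D" "inj_on Y D"
  shows "has_osc X Y P n \<or> (\<exists>j. Suc j < M \<and> (jump X Y P C M j \<or> jump Y X P C M j))"
proof (rule ccontr)
  assume neg: "\<not> ?thesis"
  then have nj: "\<And>j. Suc j < M \<Longrightarrow> \<not> jump X Y P C M j" "\<And>j. Suc j < M \<Longrightarrow> \<not> jump Y X P C M j"
    by auto
  have ws: "\<not> (before X w (C s) \<and> before Y w (C s))" if "s \<le> b" for s
  proof (cases "s = b")
    case False
    then have "s < b" "s \<le> M" using that b(2) by simp_all
    then obtain e where e: "e \<in> C s" using chain_nonempty[OF ch] by metis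
    have "X e < X d \<and> Y e < Y d" if "d \<in> C b" for d
      using chain_less[OF ch e that] \<open>s < b\<close> b(2) by simp
    then show ?thesis using w(2) e unfolding before_def by (meson less_trans)
  qed (use w(2) in simp)
  have box': "\<And>d. d \<in> D \<Longrightarrow> inside Y X (C 0) (C M) d" using box by (simp add: inside_swap)
  have D': "linked Y X D" using D(1) by (simp add: linked_swap)
  have ws': "\<not> (before Y w (C s) \<and> before X w (C s))" if "s \<le> b" for s
    using ws[OF that] by blast
  have G: "\<exists>q \<xi> \<eta>. greedy X Y D (C (c + 5 + 2 * i)) i q \<xi> \<eta> \<or> greedy Y X D (C (c + 5 + 2 * i)) i q \<xi> \<eta>"
    if "i \<le> n" for i
    using that
  proof (induction i)
    case 0
    have "c + 5 \<le> M" using b by simp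
    from greedy_start[OF ch D(2,3) box a nj this] show ?case by (metis mult_0_right add_0_right)
  next
    case (Suc i)
    define s where "s = c + 5 + 2 * i"
    have s: "s \<le> b" "s + 2 \<le> M" "Suc s < M" using Suc.prems b unfolding s_def by auto
    obtain q \<xi> \<eta> where "greedy X Y D (C s) i q \<xi> \<eta> \<or> greedy Y X D (C s) i q \<xi> \<eta>"
      using Suc unfolding s_def by auto
    then have "\<exists>q \<xi> \<eta>. greedy X Y D (C (s + 2)) (Suc i) q \<xi> \<eta> \<or> greedy Y X D (C (s + 2)) (Suc i) q \<xi> \<eta>"
    proof
      assume "greedy X Y D (C s) i q \<xi> \<eta>"
      from greedy_step[OF ch D box w(1) ws[OF s(1)] nj(1)[OF s(3)] s(2) inj(1) this]
      show ?thesis by metis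
    next
      assume "greedy Y X D (C s) i q \<xi> \<eta>"
      from greedy_step[OF chain_swap[OF ch] D' D(2,3) box' w(1) ws'[OF s(1)] nj(2)[OF s(3)] s(2) inj(2) this]
      show ?thesis by metis
    qed
    moreover have "c + 5 + 2 * Suc i = s + 2" unfolding s_def by simp
    ultimately show ?case by metis
  qed
  obtain q \<xi> \<eta> where "greedy X Y D (C (c + 5 + 2 * n)) n q \<xi> \<eta> \<or> greedy Y X D (C (c + 5 + 2 * n)) n q \<xi> \<eta>"
    using G[of n] by auto
  then have "has_osc X Y P (Suc n)"
  proof
    assume "greedy X Y D (C (c + 5 + 2 * n)) n q \<xi> \<eta>"
    then show ?thesis by (rule greedy_has_osc[OF _ D(3)])
  next
    assume "greedy Y X D (C (c + 5 + 2 * n)) n q \<xi> \<eta>"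
    then show ?thesis by (intro has_osc_swap[of Y X]) (rule greedy_has_osc[OF _ D(3)])
  qed
  then obtain p where "\<forall>i<Suc n. p i \<in> P"
    "\<forall>i j. i + 2 \<le> j \<longrightarrow> j < Suc n \<longrightarrow> X (p i) < X (p j) \<and> Y (p i) < Y (p j)"
    "\<forall>i. Suc i < Suc n \<longrightarrow> inverted X Y (p i) (p (Suc i))"
    unfolding has_osc_def by blast
  \<comment> \<open>After \<open>n\<close> steps there are \<open>n + 1\<close> pins; the last one
    is dropped.\<close>
  then have "has_osc X Y P n" unfolding has_osc_def by (intro exI[of _ p]) simp
  then show False using neg by blast
qed

text \<open>A point to the lower left of \<open>D\<close> is the only way in which we need \<open>D\<close> not to span everything.\<close>

definition slicer_closed :: "('p \<Rightarrow> int) \<Rightarrow> ('p \<Rightarrow> int) \<Rightarrow> 'p set \<Rightarrow> bool" where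
  "slicer_closed X Y P \<longleftrightarrow> (\<forall>D\<subseteq>P. (\<exists>a\<in>D. \<exists>b\<in>D. a \<noteq> b) \<longrightarrow>
     (\<exists>p\<in>P. (\<forall>d\<in>D. X p < X d \<and> Y p < Y d)) \<longrightarrow>
     (\<exists>z\<in>P. caps X Y D z \<or> caps Y X D z \<or>
        caps (\<lambda>p. - X p) (\<lambda>p. - Y p) D z \<or> caps (\<lambda>p. - Y p) (\<lambda>p. - X p) D z))"

section \<open>Outcomes for a single chain\<close>

lemma before_mono: "chain X Y C M \<Longrightarrow> before X p (C i) \<Longrightarrow> i \<le> j \<Longrightarrow> j \<le> M \<Longrightarrow> before X p (C j)"
  unfolding before_def
proof
  fix d assume ch: "chain X Y C M" and p: "\<forall>c\<in>C i. X p < X c" and ij: "i \<le> j" "j \<le> M" and d: "d \<in> C j"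
  show "X p < X d"
  proof (cases "i = j")
    case False
    obtain c where "c \<in> C i" using chain_nonempty[OF ch, of i] ij by auto
    then show ?thesis using chain_less(1)[OF ch _ d, of c i] p ij False by fastforce
  qed (use p d in simp)
qed

lemma after_mono: "chain X Y C M \<Longrightarrow> after X p (C j) \<Longrightarrow> i \<le> j \<Longrightarrow> j \<le> M \<Longrightarrow> after X p (C i)"
  unfolding after_def
proof
  fix d assume ch: "chain X Y C M" and p: "\<forall>c\<in>C j. X c < X p" and ij: "i \<le> j" "j \<le> M" and d: "d \<in> C i"
  show "X d < X p"
  proof (cases "i = j")
    case False
    obtain c where "c \<in> C j" using chain_nonempty[OF ch, of j] ij by auto
    then show ?thesis using chain_less(1)[OF ch d, of c j] p ij False by fastforce
  qed (use p d in simp)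
qed

lemma inside_mono:
  assumes "chain X Y C M" "inside X Y (C i) (C j) p" "i' \<le> i" "i \<le> M" "j \<le> j'" "j' \<le> M"
  shows "inside X Y (C i') (C j') p"
  using assms before_mono[OF assms(1)] before_mono[OF chain_swap[OF assms(1)]]
    after_mono[OF assms(1)] after_mono[OF chain_swap[OF assms(1)]]
  unfolding inside_def by blast

text \<open>Two copies are kept free at either end. A slicing point that does not rise above
  \<open>C (M - 1)\<close> is still below \<open>C M\<close>, so adding it to \<open>D\<close> stays
  within the chain, while maximality of \<open>D\<close> prevents it from being below
  \<open>C (M - 2)\<close>. This is the situation of \<open>linked_osc_or_jump\<close> with
  \<open>b = M - 2\<close>.\<close>

lemma caps_outcome:
  assumes ch: "chain X Y C M" and fin: "finite P"
    and inj: "inj_on X P" "inj_on Y P"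
    and D: "linked X Y D" "D \<subseteq> P" "a \<in> D" "a \<in> C c"
    and box: "\<And>d. d \<in> D \<Longrightarrow> inside X Y (C 2) (C (M - 2)) d"
    and mx: "\<And>z. z \<in> P \<Longrightarrow> inside X Y (C 2) (C (M - 2)) z \<Longrightarrow> linked X Y (insert z D) \<Longrightarrow> z \<in> D"
    and z: "z \<in> P" "caps X Y D z" and c: "c + 10 + 2 * n \<le> M"
  shows "saw X Y P C M \<or> has_osc X Y P n \<or>
    (\<exists>j. Suc j < M \<and> (jump X Y P C M j \<or> jump Y X P C M j))"
proof (cases "after Y z (C (M - 1))")
  case True
  have sub: "insert z D \<subseteq> P" using D(2) z(1) by simp
  obtain l r where lr: "l \<in> D" "r \<in> D" "X l < X z" "X z < X r" "Y r < Y l"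
    using caps_slices_inversion[OF D(1) z(2)] inj_on_subset[OF inj(1) sub] by blast
  have "inside X Y (C 0) (C (M - 2)) d" if "d \<in> D" for d
    by (rule inside_mono[OF ch box[OF that]]) (use c in auto)
  then have "saw X Y P C M" unfolding saw_def using lr D(2) z(1) True by blast
  then show ?thesis by simp
next
  case False
  obtain d e where d: "d \<in> D" "X d < X z" and e: "e \<in> D" "X z < X e" and Yz: "\<And>d. d \<in> D \<Longrightarrow> Y d < Y z"
    using z(2) unfolding caps_def by blast
  have z2: "after X z (C 2)" "after Y z (C 2)" "before X z (C (M - 2))"
    using box[OF d(1)] box[OF e(1)] d(2) e(2) Yz[OF d(1)]
    unfolding inside_def before_def after_def by (meson less_trans)+
  have lk: "linked X Y (insert z D)"
    using linked_insert[OF D(1)] caps_inverted[OF z(2)] by blast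
  \<comment> \<open>Otherwise \<open>mx\<close> would put \<open>z\<close> into \<open>D\<close>,
    and \<open>z\<close> would lie above itself.\<close>
  have "\<not> before Y z (C (M - 2))"
    using mx[OF z(1) _ lk] z2 Yz[of z] unfolding inside_def by auto
  moreover have "before Y z (C M)"
  proof -
    obtain b where "b \<in> C (M - 1)" "Y z \<le> Y b" using False unfolding after_def by fastforce
    then show ?thesis using chain_less(2)[OF ch, of b "M - 1" _ M] c unfolding before_def by fastforce
  qed
  moreover have "inside X Y (C 2) (C M) z"
    using z2 before_mono[OF ch z2(3), of M] c calculation(2) unfolding inside_def by auto
  ultimately have zb: "\<not> (before X z (C (M - 2)) \<and> before Y z (C (M - 2)))" "inside X Y (C 2) (C M) z"
    by auto
  have "inside X Y (C 0) (C M) p" if "p \<in> insert z D" for p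
  proof (cases "p = z")
    case True
    show ?thesis unfolding True by (rule inside_mono[OF ch zb(2)]) (use c in auto)
  next
    case False
    then have "p \<in> D" using that by simp
    then show ?thesis by (intro inside_mono[OF ch box[OF \<open>p \<in> D\<close>]]) (use c in auto)
  qed
  moreover have sub: "insert z D \<subseteq> P" using D(2) z(1) by simp
  moreover note inj_on_subset[OF inj(1) sub] inj_on_subset[OF inj(2) sub]
  moreover have "finite (insert z D)" using D(2) fin by (simp add: finite_subset)
  ultimately have "has_osc X Y P n \<or> (\<exists>j. Suc j < M \<and> (jump X Y P C M j \<or> jump Y X P C M j))"
    by (intro linked_osc_or_jump[OF ch lk _ _ _ _ D(4) _ zb(1)])
      (use D(3) c in simp_all)
  then show ?thesis by simp
qed

text \<open>A point to the right of \<open>C 0\<close> cannot also be to its left. This keeps the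
  mirrored index \<open>M - Suc j\<close> of \<open>jump_neg\<close> in the range of the
  colours.\<close>

lemma jump_pos: "chain X Y C M \<Longrightarrow> jump X Y P C M j \<Longrightarrow> 0 < j"
  unfolding jump_def inside_def before_def after_def
  by (metis chain_nonempty gr0I le0 less_asym)

text \<open>The colours for Ramsey's theorem: \<open>0\<close> to \<open>3\<close> are the four sides of the chain on which the
  slicing point may lie, followed by \<open>M\<close> colours each for jumps to the upper left and to the
  lower right.\<close>

definition outcome :: "('p \<Rightarrow> int) \<Rightarrow> ('p \<Rightarrow> int) \<Rightarrow> 'p set \<Rightarrow> nat \<Rightarrow> nat \<Rightarrow> (nat \<Rightarrow> 'p set) \<Rightarrow> bool" where
  "outcome X Y P M \<xi> C \<longleftrightarrow>
     (if \<xi> = 0 then saw X Y P C M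
      else if \<xi> = 1 then saw Y X P C M
      else if \<xi> = 2 then saw (\<lambda>p. - X p) (\<lambda>p. - Y p) P (\<lambda>i. C (M - i)) M
      else if \<xi> = 3 then saw (\<lambda>p. - Y p) (\<lambda>p. - X p) P (\<lambda>i. C (M - i)) M
      else if \<xi> < 4 + M then Suc (\<xi> - 4) < M \<and> jump X Y P C M (\<xi> - 4)
      else Suc (\<xi> - 4 - M) < M \<and> jump Y X P C M (\<xi> - 4 - M))"

text \<open>The family \<open>F\<close> is symmetric under reversal of the chain and exchange of the
  axes, so the same maximal \<open>D\<close> serves for slicing points on all four sides, each
  reduced to \<open>caps_outcome\<close> by a symmetry.\<close>

lemma chain_outcome:
  assumes ch: "chain X Y C M" and CP: "\<And>i. i \<le> M \<Longrightarrow> C i \<subseteq> P" and fin: "finite P"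
    and inj: "inj_on X P" "inj_on Y P" and sl: "slicer_closed X Y P"
    and M: "M = 20 + 4 * n"
  shows "has_osc X Y P n \<or> (\<exists>\<xi> < 4 + 2 * M. outcome X Y P M \<xi> C)"
proof -
  \<comment> \<open>The middle index: \<open>M - c = c\<close> fixes it under the half turn.\<close>
  define c where "c = 10 + 2 * n"
  have c: "c + 10 + 2 * n \<le> M" "c \<le> M" "2 < c" "c < M - 2" "M - c = c" using M unfolding c_def by auto
  obtain a b where ab: "C c = {a, b}" "inverted X Y a b" using ch c(2) unfolding chain_def by blast
  define F where "F = {D. linked X Y D \<and> D \<subseteq> P \<and> C c \<subseteq> D \<and> (\<forall>d\<in>D. inside X Y (C 2) (C (M - 2)) d)}"
  have "F \<subseteq> Pow P" unfolding F_def by auto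
  then have "finite F" using fin by (meson finite_Pow_iff finite_subset)
  moreover have "C c \<in> F"
  proof -
    have "X e < X d \<and> Y e < Y d" if "e \<in> C 2" "d \<in> C c" for e d
      using chain_less[OF ch that] c by auto
    moreover have "X d < X e \<and> Y d < Y e" if "e \<in> C (M - 2)" "d \<in> C c" for e d
      using chain_less[OF ch that(2,1)] c by auto
    ultimately show ?thesis
      unfolding F_def using linked_pair[OF ab(2)] CP[OF c(2)] ab(1)
      unfolding inside_def before_def after_def by auto
  qed
  ultimately obtain D where DF: "D \<in> F" and Dmax: "\<And>E. E \<in> F \<Longrightarrow> D \<subseteq> E \<Longrightarrow> D = E"
    using finite_has_maximal2[of F "C c"] by metis
  have D: "linked X Y D" "D \<subseteq> P" "C c \<subseteq> D" "\<And>d. d \<in> D \<Longrightarrow> inside X Y (C 2) (C (M - 2)) d"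
    using DF unfolding F_def by auto
  have mx: "z \<in> D" if "z \<in> P" "inside X Y (C 2) (C (M - 2)) z" "linked X Y (insert z D)" for z
    using Dmax[of "insert z D"] that D unfolding F_def by auto
  have a: "a \<in> D" "a \<in> C c" using D(3) ab(1) by auto
  have "b \<in> D" "a \<noteq> b" using D(3) ab unfolding inverted_def by auto
  \<comment> \<open>A point of \<open>C 2\<close> is the point to the lower left of \<open>D\<close>
    that \<open>slicer_closed\<close> asks for.\<close>
  moreover obtain e where "e \<in> C 2" using chain_nonempty[OF ch, of 2] c by auto
  moreover have "e \<in> P" using CP[of 2] \<open>e \<in> C 2\<close> c by auto
  moreover have "\<forall>d\<in>D. X e < X d \<and> Y e < Y d"
    using D(4) \<open>e \<in> C 2\<close> unfolding inside_def after_def by blast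
  ultimately obtain z where z: "z \<in> P" and caps: "caps X Y D z \<or> caps Y X D z \<or>
        caps (\<lambda>p. - X p) (\<lambda>p. - Y p) D z \<or> caps (\<lambda>p. - Y p) (\<lambda>p. - X p) D z"
    using sl D(2) a(1) unfolding slicer_closed_def by metis
  define G where "G \<longleftrightarrow> (\<exists>\<xi> < 4 + 2 * M. outcome X Y P M \<xi> C)"
  have j1: G if "jump X Y P C M j" "Suc j < M" for j
    using that unfolding G_def by (intro exI[of _ "j + 4"]) (simp add: outcome_def)
  have j2: G if "jump Y X P C M j" "Suc j < M" for j
    using that unfolding G_def by (intro exI[of _ "j + 4 + M"]) (simp add: outcome_def)
  have s0: G if "saw X Y P C M"
    using that unfolding G_def by (intro exI[of _ 0]) (simp add: outcome_def)
  have s1: G if "saw Y X P C M"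
    using that unfolding G_def by (intro exI[of _ 1]) (simp add: outcome_def)
  let ?C = "\<lambda>i. C (M - i)" and ?X = "\<lambda>p. - X p" and ?Y = "\<lambda>p. - Y p"
  have ninj: "inj_on ?X P" "inj_on ?Y P" using inj unfolding inj_on_def by auto
  have M2: "M - (M - 2) = 2" using M by simp
  have s2: G if "saw ?X ?Y P ?C M"
    using that unfolding G_def by (intro exI[of _ 2]) (simp add: outcome_def)
  have s3: G if "saw ?Y ?X P ?C M"
    using that unfolding G_def by (intro exI[of _ 3]) (simp add: outcome_def)
  have j3: G if "jump ?X ?Y P ?C M j" "Suc j < M" for j
    using j2[OF jump_neg[OF that(1)]] that(2) jump_pos[OF chain_neg[OF ch] that(1)] by simp
  have j4: G if "jump ?Y ?X P ?C M j" "Suc j < M" for j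
    using j1[OF jump_neg[OF that(1)]] that(2) jump_pos[OF chain_neg[OF chain_swap[OF ch]] that(1)] by simp
  from caps have "has_osc X Y P n \<or> G"
  proof (elim disjE)
    assume cz: "caps X Y D z"
    have "saw X Y P C M \<or> has_osc X Y P n \<or>
        (\<exists>j. Suc j < M \<and> (jump X Y P C M j \<or> jump Y X P C M j))"
      by (rule caps_outcome[OF ch fin inj D(1,2) a D(4) mx z cz c(1)])
    then show ?thesis using s0 j1 j2 by blast
  next
    assume cz: "caps Y X D z"
    have "saw Y X P C M \<or> has_osc Y X P n \<or>
        (\<exists>j. Suc j < M \<and> (jump Y X P C M j \<or> jump X Y P C M j))"
      by (rule caps_outcome[OF chain_swap[OF ch] fin inj(2,1) _ D(2) a _ _ z cz c(1)])
        (use D(1,4) mx in \<open>auto simp: linked_swap[of Y X] inside_swap[of Y X]\<close>)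
    then show ?thesis using s1 j1 j2 has_osc_swap[of Y X P n] by blast
  next
    assume cz: "caps ?X ?Y D z"
    have "saw ?X ?Y P ?C M \<or> has_osc ?X ?Y P n \<or>
        (\<exists>j. Suc j < M \<and> (jump ?X ?Y P ?C M j \<or> jump ?Y ?X P ?C M j))"
      by (rule caps_outcome[OF chain_neg[OF ch] fin ninj _ D(2) a(1) _ _ _ z cz c(1)])
        (use D(1,4) mx a(2) c(5) in \<open>auto simp: linked_neg[of X Y] inside_neg[of X Y] M2\<close>)
    then show ?thesis using s2 j3 j4 has_osc_neg[of X Y P n] by blast
  next
    assume cz: "caps ?Y ?X D z"
    have "saw ?Y ?X P ?C M \<or> has_osc ?Y ?X P n \<or>
        (\<exists>j. Suc j < M \<and> (jump ?Y ?X P ?C M j \<or> jump ?X ?Y P ?C M j))"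
      by (rule caps_outcome[OF chain_neg[OF chain_swap[OF ch]] fin ninj(2,1) _ D(2) a(1) _ _ _ z cz c(1)])
        (use D(1,4) mx a(2) c(5) in \<open>auto simp: linked_neg[of Y X] inside_neg[of Y X]
          linked_swap[of Y X] inside_swap[of Y X] M2\<close>)
    then show ?thesis using s3 j3 j4 has_osc_neg[of Y X P n] has_osc_swap[of Y X P n] by blast
  qed
  then show ?thesis unfolding G_def .
qed

section \<open>Homogeneous chains\<close>

lemma sorted_list_of_set_image_nth:
  assumes t: "strict_mono_on {..<k} t" and i: "i < k"
  shows "sorted_list_of_set (t ` {..<k}) ! i = (t i :: nat)"
proof -
  have "sorted_wrt (<) (map t [0..<k])"
    using t by (auto simp: sorted_wrt_iff_nth_less strict_mono_on_def)
  then have "sorted_list_of_set (set (map t [0..<k])) = map t [0..<k]"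
    by (intro sorted_list_of_set.idem_if_sorted_distinct) (auto simp: strict_sorted_iff)
  moreover have "set (map t [0..<k]) = t ` {..<k}" by auto
  ultimately show ?thesis using i by simp
qed

text \<open>Ramsey's theorem for \<open>k\<close>-sets and \<open>r\<close> colours, with a set
  represented by its increasing enumeration, of which \<open>R\<close> may see only the first
  \<open>k\<close> values. Colours need not exclude each other, so outcomes can serve as colours
  directly.\<close>

lemma ramsey_increasing:
  fixes k r K :: nat
  shows "\<exists>N :: nat. \<forall>R :: nat \<Rightarrow> (nat \<Rightarrow> nat) \<Rightarrow> bool.
    (\<forall>\<xi> s t. R \<xi> s \<longrightarrow> (\<forall>i<k. s i = t i) \<longrightarrow> R \<xi> t) \<longrightarrow>
    (\<forall>t. strict_mono_on {..<k} t \<longrightarrow> (\<forall>i<k. t i < N) \<longrightarrow> (\<exists>\<xi><r. R \<xi> t)) \<longrightarrow>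
    (\<exists>\<xi><r. \<exists>h. strict_mono_on {..<K} h \<and> (\<forall>i<K. h i < N) \<and>
      (\<forall>s. strict_mono_on {..<k} s \<longrightarrow> (\<forall>i<k. s i < K) \<longrightarrow> R \<xi> (\<lambda>i. h (s i))))"
proof -
  obtain N :: nat where N: "partn_lst {..<N} (replicate r K) k"
    using ramsey_full by blast
  show ?thesis
  proof (rule exI[of _ N], intro allI impI)
    fix R :: "nat \<Rightarrow> (nat \<Rightarrow> nat) \<Rightarrow> bool"
    assume cong: "\<forall>\<xi> s t. R \<xi> s \<longrightarrow> (\<forall>i<k. s i = t i) \<longrightarrow> R \<xi> t"
      and col: "\<forall>t. strict_mono_on {..<k} t \<longrightarrow> (\<forall>i<k. t i < N) \<longrightarrow> (\<exists>\<xi><r. R \<xi> t)"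
    define enum where "enum T i = sorted_list_of_set T ! i" for T :: "nat set" and i
    have enum_mono: "strict_mono_on {..<card T} (enum T)" and enum_in: "\<And>i. i < card T \<Longrightarrow> enum T i \<in> T"
      if "finite T" for T
    proof -
      have "sorted_wrt (<) (sorted_list_of_set T)" by simp
      then show "strict_mono_on {..<card T} (enum T)"
        unfolding enum_def by (auto simp: sorted_wrt_iff_nth_less strict_mono_on_def)
      show "enum T i \<in> T" if "i < card T" for i
        using that \<open>finite T\<close> nth_mem[of i "sorted_list_of_set T"] unfolding enum_def by simp
    qed
    \<comment> \<open>Several colours may apply to \<open>T\<close>; one of them is chosen.\<close>
    define f where "f T = (SOME \<xi>. \<xi> < r \<and> R \<xi> (enum T))" for T
    have f: "f T < r \<and> R (f T) (enum T)" if "T \<in> [{..<N}]\<^bsup>k\<^esup>" for T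
    proof -
      have T: "finite T" "card T = k" "T \<subseteq> {..<N}" using that unfolding nsets_def by auto
      then have "\<exists>\<xi><r. R \<xi> (enum T)"
        using col[rule_format, of "enum T"] enum_mono[of T] enum_in[of T] by auto
      then show ?thesis unfolding f_def by (rule someI_ex[of "\<lambda>\<xi>. \<xi> < r \<and> R \<xi> (enum T)"])
    qed
    obtain \<xi> H where \<xi>: "\<xi> < r" and H: "H \<in> [{..<N}]\<^bsup>K\<^esup>" and fH: "f ` [H]\<^bsup>k\<^esup> \<subseteq> {\<xi>}"
      using partn_lstE[OF N, of f r] f by (auto simp: Pi_iff)
    have Hf: "finite H" "card H = K" "H \<subseteq> {..<N}" using H unfolding nsets_def by auto
    have "R \<xi> (\<lambda>i. enum H (s i))" if s: "strict_mono_on {..<k} s" "\<forall>i<k. s i < K" for s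
    proof -
      define t where "t i = enum H (s i)" for i
      have t: "strict_mono_on {..<k} t"
        using s enum_mono[OF Hf(1)] Hf(2) unfolding t_def strict_mono_on_def by auto
      have "t ` {..<k} \<subseteq> H" using s(2) enum_in[OF Hf(1)] Hf(2) unfolding t_def by auto
      moreover have "card (t ` {..<k}) = k"
        using card_image[OF strict_mono_on_imp_inj_on[OF t]] by simp
      ultimately have T: "t ` {..<k} \<in> [H]\<^bsup>k\<^esup>" unfolding nsets_def by auto
      then have "f (t ` {..<k}) = \<xi>" using fH by auto
      moreover have "t ` {..<k} \<in> [{..<N}]\<^bsup>k\<^esup>" using T nsets_mono[OF Hf(3)] by blast
      ultimately have "R \<xi> (enum (t ` {..<k}))" using f by blast
      moreover have "\<forall>i<k. enum (t ` {..<k}) i = t i"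
        unfolding enum_def by (simp add: sorted_list_of_set_image_nth[OF t])
      ultimately have "R \<xi> t" using cong by blast
      then show ?thesis unfolding t_def .
    qed
    moreover have "strict_mono_on {..<K} (enum H)" "\<forall>i<K. enum H i < N"
      using enum_mono[OF Hf(1)] enum_in[OF Hf(1)] Hf by auto
    ultimately show "\<exists>\<xi><r. \<exists>h. strict_mono_on {..<K} h \<and> (\<forall>i<K. h i < N) \<and>
        (\<forall>s. strict_mono_on {..<k} s \<longrightarrow> (\<forall>i<k. s i < K) \<longrightarrow> R \<xi> (\<lambda>i. h (s i)))"
      using \<xi> by blast
  qed
qed

text \<open>Ramsey's theorem for pairs, coloured by whether \<open>f\<close> rises or falls: a
  qualitative form of the Erdos-Szekeres theorem.\<close>

lemma monotone_subsequence:
  fixes n :: nat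
  shows "\<exists>N :: nat. \<forall>f :: nat \<Rightarrow> int. inj_on f {..<N} \<longrightarrow>
    (\<exists>h. strict_mono_on {..<n} h \<and> (\<forall>i<n. h i < N) \<and>
      ((\<forall>i j. i < j \<longrightarrow> j < n \<longrightarrow> f (h i) < f (h j)) \<or> (\<forall>i j. i < j \<longrightarrow> j < n \<longrightarrow> f (h j) < f (h i))))"
proof -
  obtain N :: nat where N: "\<forall>R :: nat \<Rightarrow> (nat \<Rightarrow> nat) \<Rightarrow> bool.
    (\<forall>\<xi> s t. R \<xi> s \<longrightarrow> (\<forall>i<2. s i = t i) \<longrightarrow> R \<xi> t) \<longrightarrow>
    (\<forall>t. strict_mono_on {..<2} t \<longrightarrow> (\<forall>i<2. t i < N) \<longrightarrow> (\<exists>\<xi><2. R \<xi> t)) \<longrightarrow>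
    (\<exists>\<xi><2. \<exists>h. strict_mono_on {..<n} h \<and> (\<forall>i<n. h i < N) \<and>
      (\<forall>s. strict_mono_on {..<2} s \<longrightarrow> (\<forall>i<2. s i < n) \<longrightarrow> R \<xi> (\<lambda>i. h (s i))))"
    using ramsey_increasing[of 2 2 n] by (elim exE) (rule that)
  show ?thesis
  proof (rule exI[of _ N], intro allI impI)
    fix f :: "nat \<Rightarrow> int" assume f: "inj_on f {..<N}"
    define R where "R \<xi> t \<longleftrightarrow> (if \<xi> = 0 then f (t 0) < f (t 1) else f (t 1) < f (t 0))"
      for \<xi> :: nat and t :: "nat \<Rightarrow> nat"
    have "\<exists>\<xi><2. R \<xi> t" if t: "strict_mono_on {..<2} t" "\<forall>i<2. t i < N" for t
    proof -
      have "t 0 < t 1" using t(1) unfolding strict_mono_on_def by auto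
      moreover have "t 0 < N" "t 1 < N" using t(2) by auto
      ultimately have "f (t 0) \<noteq> f (t 1)" using f unfolding inj_on_def by (metis lessThan_iff less_irrefl)
      then consider "R 0 t" | "R 1 t" unfolding R_def by fastforce
      then show ?thesis by cases (auto intro: exI[of _ "0 :: nat"] exI[of _ "1 :: nat"])
    qed
    moreover have "R \<xi> t" if "R \<xi> s" "\<forall>i<2. s i = t i" for \<xi> s t
      using that unfolding R_def by auto
    ultimately obtain \<xi> h where \<xi>: "\<xi> < 2" and h: "strict_mono_on {..<n} h" "\<forall>i<n. h i < N"
      and R: "\<And>s. strict_mono_on {..<2} s \<Longrightarrow> \<forall>i<2. s i < n \<Longrightarrow> R \<xi> (\<lambda>i. h (s i))"
      using N[rule_format, of R] by blast
    \<comment> \<open>The pair \<open>{i, j}\<close> as an increasing sequence of length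
      two.\<close>
    have "R \<xi> (\<lambda>k. h (if k = 0 then i else j))" if "i < j" "j < n" for i j
      using that by (intro R) (auto simp: strict_mono_on_def less_2_cases_iff)
    then show "\<exists>h. strict_mono_on {..<n} h \<and> (\<forall>i<n. h i < N) \<and>
      ((\<forall>i j. i < j \<longrightarrow> j < n \<longrightarrow> f (h i) < f (h j)) \<or> (\<forall>i j. i < j \<longrightarrow> j < n \<longrightarrow> f (h j) < f (h i)))"
      using h unfolding R_def by (cases "\<xi> = 0") auto
  qed
qed

text \<open>A point \<open>d (m + 2)\<close> of the chain lies to the lower right of
  \<open>z m\<close> and \<open>z (m + 1)\<close> and forms no inversion with any other
  \<open>z k\<close>. Hence \<open>z 0\<close>, \<open>d 2\<close>, \<open>z 1\<close>,
  \<open>d 3\<close>, and so on is an oscillation.\<close>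

lemma has_osc_staircase:
  assumes ch: "chain X Y D (n + 3)" and DP: "\<And>i. i \<le> n + 3 \<Longrightarrow> D i \<subseteq> P"
    and z: "\<And>i. i < n \<Longrightarrow> z i \<in> P"
      "\<And>i. i < n \<Longrightarrow> after X (z i) (D i)" "\<And>i. i < n \<Longrightarrow> before X (z i) (D (i + 1))"
      "\<And>i. i < n \<Longrightarrow> after Y (z i) (D (i + 2))" "\<And>i. i < n \<Longrightarrow> before Y (z i) (D (i + 3))"
  shows "has_osc X Y P n"
proof -
  have "\<exists>c. c \<in> D i" if "i \<le> n + 3" for i using chain_nonempty[OF ch that] by metis
  then obtain d where d: "\<And>i. i \<le> n + 3 \<Longrightarrow> d i \<in> D i" by metis
  have dd: "X (d i) < X (d j)" "Y (d i) < Y (d j)" if "i < j" "j \<le> n + 3" for i j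
    using chain_less[OF ch d d that] that by auto
  have z': "X (d i) < X (z i)" "X (z i) < X (d (i + 1))" "Y (d (i + 2)) < Y (z i)" "Y (z i) < Y (d (i + 3))"
    if "i < n" for i
    using z(2-5)[OF that] d that unfolding before_def after_def by auto
  define q where "q m = (if even m then z (m div 2) else d (m div 2 + 2))" for m
  have le: "X (d i) \<le> X (d j)" "Y (d i) \<le> Y (d j)" if "i \<le> j" "j \<le> n + 3" for i j
    using dd[of i j] that by (cases "i = j"; force)+
  have "q m \<in> P" if "m < n" for m
  proof (cases "even m")
    case True
    then show ?thesis using z(1)[of "m div 2"] that unfolding q_def by simp
  next
    case False
    have "m div 2 + 2 \<le> n + 3" using that by simp
    then have "d (m div 2 + 2) \<in> P" using d DP by blast
    then show ?thesis using False unfolding q_def by simp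
  qed
  moreover have "X (q i) < X (q j) \<and> Y (q i) < Y (q j)" if ij: "i + 2 \<le> j" "j < n" for i j
  proof -
    define a b where "a = i div 2" and "b = j div 2"
    have ab: "a < b" "b < n" using ij unfolding a_def b_def by auto
    \<comment> \<open>For these parities the distance is at least three, which gives the copy that
      separates the two points.\<close>
    have gap: "a + 2 \<le> b" if "odd i" "even j" using ij that unfolding a_def b_def by presburger
    show ?thesis
      using z'[of a] z'[of b] ab le[of "a + 1" b] le[of "a + 3" "b + 2"] le[of "a + 1" "b + 2"]
        le[of "a + 2" b] dd[of "a + 2" "b + 2"] gap
      unfolding q_def a_def[symmetric] b_def[symmetric] by (cases "even i"; cases "even j") auto
  qed
  moreover have "inverted X Y (q i) (q (Suc i))" if i: "Suc i < n" for i
  proof -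
    define m where "m = i div 2"
    show ?thesis
    proof (cases "even i")
      case True
      then have q: "q (Suc i) = d (m + 2)" "q i = z m" and m: "m < n"
        using i unfolding q_def m_def by auto
      have "X (z m) < X (d (m + 2))" using z'(2)[OF m] dd(1)[of "m + 1" "m + 2"] m by simp
      then show ?thesis using z'(3)[OF m] unfolding q inverted_def by simp
    next
      case False
      then have q: "q (Suc i) = z (m + 1)" "q i = d (m + 2)" and m: "m + 1 < n"
        using i unfolding q_def m_def by auto
      have "Y (d (m + 2)) < Y (d (m + 1 + 2))" using dd(2) m by simp
      then have "Y (d (m + 2)) < Y (z (m + 1))" using z'(3)[OF m] by simp
      moreover have "X (z (m + 1)) < X (d (m + 2))" using z'(2)[OF m] by (simp add: numeral_2_eq_2)
      ultimately show ?thesis unfolding q inverted_def by simp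
    qed
  qed
  ultimately show ?thesis unfolding has_osc_def by blast
qed

lemma chain_subseq:
  assumes "chain X Y C K" "strict_mono_on {..M} s" "\<And>i. i \<le> M \<Longrightarrow> s i \<le> K"
  shows "chain X Y (\<lambda>i. C (s i)) M"
  unfolding chain_def
proof (intro conjI allI impI)
  show "\<exists>a b. C (s i) = {a, b} \<and> inverted X Y a b" if "i \<le> M" for i
    using assms(1) assms(3)[OF that] unfolding chain_def by blast
next
  fix i j assume "i < j" "j \<le> M"
  then have "s i < s j" "s j \<le> K" using assms(2,3) unfolding strict_mono_on_def by auto
  then show "\<forall>c\<in>C (s i). \<forall>d\<in>C (s j). X c < X d \<and> Y c < Y d"
    using chain_less[OF assms(1)] by simp
qed

text \<open>Every subchain jumps at the same index \<open>j\<close>. Choosing subchains with a wide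
  gap after index \<open>j\<close> prescribes which part of the chain is jumped over, and shifting
  them block by block produces the staircase of \<open>has_osc_staircase\<close>.\<close>

lemma jump_homogeneous:
  assumes ch: "chain X Y C K" and CP: "\<And>i. i \<le> K \<Longrightarrow> C i \<subseteq> P"
    and J: "\<And>s. strict_mono_on {..M} s \<Longrightarrow> (\<And>i. i \<le> M \<Longrightarrow> s i \<le> K) \<Longrightarrow> jump X Y P (\<lambda>i. C (s i)) M j"
    and j: "Suc j < M" and K: "(n + 3) * (M + 1) \<le> K"
  shows "has_osc X Y P n"
proof -
  define A where "A = M + 1"
  have mul: "i * A \<le> K" if "i \<le> n + 3" for i
    using mult_right_mono[OF that, of A] K unfolding A_def by simp
  have "\<exists>z\<in>P. after X z (C (i * A)) \<and> before X z (C ((i + 1) * A)) \<and>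
      after Y z (C ((i + 2) * A)) \<and> before Y z (C ((i + 3) * A))" if i: "i < n" for i
  proof -
    define a where "a = i * A"
    have iA: "(i + 1) * A = a + A" "(i + 2) * A = a + 2 * A" "(i + 3) * A = a + 3 * A"
      unfolding a_def by (simp_all add: algebra_simps)
    have aK: "a + 3 * A \<le> K" using mul[of "i + 3"] i iA by simp
    \<comment> \<open>Copies up to \<open>j\<close> come from block \<open>i\<close> and the others
      from block \<open>i + 2\<close>. This confines the abscissa of the jumping point to block
      \<open>i\<close> and its height to block \<open>i + 2\<close>.\<close>
    define s where "s k = (if k \<le> j then a + k else a + 2 * A + (k - Suc j))" for k
    have sK: "s k \<le> K" if "k \<le> M" for k
      using that j aK unfolding s_def A_def by (cases "k \<le> j") simp_all
    have "s p < s q" if "p < q" "q \<le> M" for p q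
    proof (cases "p \<le> j \<and> \<not> q \<le> j")
      case True
      then have "s p = a + p" "s q = a + 2 * A + (q - Suc j)" unfolding s_def by auto
      moreover have "p < A" using that unfolding A_def by simp
      ultimately show ?thesis by simp
    next
      case False
      then show ?thesis using that unfolding s_def by auto
    qed
    then have "strict_mono_on {..M} s" unfolding strict_mono_on_def by simp
    then obtain p where p: "p \<in> P" "inside X Y (C (s 0)) (C (s M)) p" "before X p (C (s j))" "after Y p (C (s (Suc j)))"
      using J[of s] sK unfolding jump_def by blast
    have s: "s 0 = a" "s j = a + j" "s (Suc j) = a + 2 * A" "s M = a + 2 * A + (M - Suc j)"
      using j unfolding s_def by simp_all
    have "before X p (C (a + A))"
      by (rule before_mono[OF ch p(3)]) (use s j aK in \<open>simp_all add: A_def\<close>)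
    moreover have "before Y p (C (a + 3 * A))"
      by (rule before_mono[OF chain_swap[OF ch], of p "s M"])
        (use p(2) s j aK in \<open>simp_all add: A_def inside_def\<close>)
    ultimately show ?thesis
      unfolding iA unfolding a_def[symmetric] using p s unfolding inside_def by metis
  qed
  then obtain z where z: "\<And>i. i < n \<Longrightarrow> z i \<in> P \<and> after X (z i) (C (i * A)) \<and> before X (z i) (C ((i + 1) * A)) \<and>
      after Y (z i) (C ((i + 2) * A)) \<and> before Y (z i) (C ((i + 3) * A))" by metis
  have "chain X Y (\<lambda>i. C (i * A)) (n + 3)"
  proof (rule chain_subseq[OF ch])
    show "strict_mono_on {..n + 3} (\<lambda>i. i * A)"
      unfolding strict_mono_on_def A_def by (simp del: add_mult_distrib2 mult_Suc_right)
  qed (rule mul)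
  then show ?thesis
    by (rule has_osc_staircase) (use z CP mul in auto)
qed

text \<open>A sawtooth alternation in the coordinates \<open>X\<close>, \<open>Y\<close>:
  \<open>l i\<close> and \<open>r i\<close> are the upper left and lower right points of a copy of
  21, and \<open>z i\<close> slices it from above. The two cases of the last clause correspond to
  parallel and wedge.\<close>

definition toothed :: "('p \<Rightarrow> int) \<Rightarrow> ('p \<Rightarrow> int) \<Rightarrow> 'p set \<Rightarrow> nat \<Rightarrow> (nat \<Rightarrow> 'p) \<Rightarrow> (nat \<Rightarrow> 'p) \<Rightarrow> (nat \<Rightarrow> 'p) \<Rightarrow> bool" where
  "toothed X Y P n l r z \<longleftrightarrow>
     (\<forall>i<n. l i \<in> P \<and> r i \<in> P \<and> z i \<in> P \<and> X (l i) < X (z i) \<and> X (z i) < X (r i) \<and> Y (r i) < Y (l i)) \<and>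
     (\<forall>i j. i < j \<longrightarrow> j < n \<longrightarrow> X (r i) < X (l j) \<and> Y (l i) < Y (r j)) \<and>
     (\<forall>i<n. \<forall>j<n. Y (l i) < Y (z j)) \<and>
     ((\<forall>i j. i < j \<longrightarrow> j < n \<longrightarrow> Y (z i) < Y (z j)) \<or> (\<forall>i j. i < j \<longrightarrow> j < n \<longrightarrow> Y (z j) < Y (z i)))"

text \<open>Put the first \<open>M - 1\<close> copies of a subchain into block \<open>i\<close> and
  the last two at the end of the chain. The inversion then stays in block \<open>i\<close>, while
  the slicing point rises above all \<open>N\<close> blocks. A monotone subsequence of the heights
  of the slicing points finishes the proof.\<close>

lemma saw_homogeneous:
  fixes n :: nat
  shows "\<exists>N :: nat. \<forall>(X :: 'p \<Rightarrow> int) Y P C K M. chain X Y C K \<longrightarrow> inj_on Y P \<longrightarrow>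
      (\<forall>s. strict_mono_on {..M} s \<longrightarrow> (\<forall>i\<le>M. s i \<le> K) \<longrightarrow> saw X Y P (\<lambda>i. C (s i)) M) \<longrightarrow>
      2 \<le> M \<longrightarrow> (N + 1) * (M + 1) \<le> K \<longrightarrow> (\<exists>l r z. toothed X Y P n l r z)"
proof -
  obtain N :: nat where N: "\<forall>f :: nat \<Rightarrow> int. inj_on f {..<N} \<longrightarrow>
    (\<exists>h. strict_mono_on {..<n} h \<and> (\<forall>i<n. h i < N) \<and>
      ((\<forall>i j. i < j \<longrightarrow> j < n \<longrightarrow> f (h i) < f (h j)) \<or> (\<forall>i j. i < j \<longrightarrow> j < n \<longrightarrow> f (h j) < f (h i))))"
    using monotone_subsequence[of n] by (elim exE) (rule that)
  show ?thesis
  proof (rule exI[of _ N], intro allI impI)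
    fix X Y :: "'p \<Rightarrow> int" and P C and K M :: nat
    assume ch: "chain X Y C K" and inj: "inj_on Y P"
      and S: "\<forall>s. strict_mono_on {..M} s \<longrightarrow> (\<forall>i\<le>M. s i \<le> K) \<longrightarrow> saw X Y P (\<lambda>i. C (s i)) M"
      and M: "2 \<le> M" and K: "(N + 1) * (M + 1) \<le> K"
    define A where "A = M + 1"
    \<comment> \<open>A full block of length \<open>A\<close> stays free at the top for the two
      copies that are moved there.\<close>
    have mul: "(i + 1) * A \<le> K - A" if "i < N" for i
    proof -
      have "(i + 1) * A \<le> N * A" using that by (intro mult_right_mono) auto
      then show ?thesis using K unfolding A_def by simp
    qed
    have AK: "A \<le> K" using K unfolding A_def by simp
    have "\<exists>l\<in>P. \<exists>r\<in>P. \<exists>z\<in>P. inside X Y (C (i * A)) (C ((i + 1) * A)) l \<and> inside X Y (C (i * A)) (C ((i + 1) * A)) r \<and>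
        X l < X z \<and> X z < X r \<and> Y r < Y l \<and> after Y z (C (K - 1))" if i: "i < N" for i
    proof -
      define s where "s k = (if k + 2 \<le> M then i * A + k else K + k - M)" for k
      have i1: "(i + 1) * A = i * A + A" by simp
      have "strict_mono_on {..M} s" "\<And>k. k \<le> M \<Longrightarrow> s k \<le> K"
        using mul[OF i] AK i1 unfolding strict_mono_on_def s_def A_def by auto
      then obtain l r z where lrz: "l \<in> P" "r \<in> P" "z \<in> P"
        "inside X Y (C (s 0)) (C (s (M - 2))) l" "inside X Y (C (s 0)) (C (s (M - 2))) r"
        "X l < X z" "X z < X r" "Y r < Y l" "after Y z (C (s (M - 1)))"
        using S[rule_format, of s] unfolding saw_def by blast
      have s: "s 0 = i * A" "s (M - 2) = i * A + (M - 2)" "s (M - 1) = K - 1"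
        using M unfolding s_def by auto
      have "inside X Y (C (i * A)) (C ((i + 1) * A)) p" if "inside X Y (C (s 0)) (C (s (M - 2))) p" for p
        by (rule inside_mono[OF ch that]) (use s mul[OF i] i1 AK in \<open>auto simp: A_def\<close>)
      then show ?thesis using lrz s by metis
    qed
    then obtain l r z where lrz: "\<And>i. i < N \<Longrightarrow> l i \<in> P \<and> r i \<in> P \<and> z i \<in> P \<and>
        inside X Y (C (i * A)) (C ((i + 1) * A)) (l i) \<and> inside X Y (C (i * A)) (C ((i + 1) * A)) (r i) \<and>
        X (l i) < X (z i) \<and> X (z i) < X (r i) \<and> Y (r i) < Y (l i) \<and> after Y (z i) (C (K - 1))"
      by metis
    \<comment> \<open>The copy at the start of block \<open>j\<close> separates the inversions of
      the two blocks.\<close>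
    have sep: "X p < X q \<and> Y p < Y q"
      if "i < j" "j < N" "p \<in> {l i, r i}" "q \<in> {l j, r j}" for i j p q
    proof -
      have jK: "j * A \<le> K" using mul[OF that(2)] by simp
      have ij: "(i + 1) * A \<le> j * A" using that(1) by (intro mult_right_mono) auto
      have "i * A \<le> (i + 1) * A" by simp
      then have "i * A \<le> K" using ij jK by linarith
      obtain c where c: "c \<in> C (j * A)" using chain_nonempty[OF ch jK] .
      have "inside X Y (C (i * A)) (C ((i + 1) * A)) p" "inside X Y (C (j * A)) (C ((j + 1) * A)) q"
        using lrz[of i] lrz[of j] that by auto
      moreover have "inside X Y (C (i * A)) (C (j * A)) p"
        by (rule inside_mono[OF ch calculation(1)])
          (use ij jK \<open>i * A \<le> K\<close> in simp_all)
      ultimately show ?thesis using c unfolding inside_def before_def after_def by (meson less_trans)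
    qed
    have top: "Y (l i) < Y (z j)" if "i < N" "j < N" for i j
    proof -
      obtain c where c: "c \<in> C (K - 1)" using chain_nonempty[OF ch, of "K - 1"] by auto
      have "before Y (l i) (C (K - 1))"
        using before_mono[OF chain_swap[OF ch], of "l i" "(i + 1) * A" "K - 1"] lrz[OF that(1)] mul[OF that(1)] AK
        unfolding inside_def A_def by auto
      then show ?thesis using lrz[OF that(2)] c unfolding before_def after_def by (meson less_trans)
    qed
    have "z i \<noteq> z j" if "i < j" "j < N" for i j
      using sep[OF that, of "r i" "l j"] lrz[of i] lrz[of j] that by auto
    then have "inj_on (\<lambda>i. Y (z i)) {..<N}"
      using inj lrz unfolding inj_on_def by (metis lessThan_iff linorder_neqE_nat)
    from N[rule_format, OF this] obtain h where h: "strict_mono_on {..<n} h" "\<forall>i<n. h i < N"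
      "(\<forall>i j. i < j \<longrightarrow> j < n \<longrightarrow> Y (z (h i)) < Y (z (h j))) \<or> (\<forall>i j. i < j \<longrightarrow> j < n \<longrightarrow> Y (z (h j)) < Y (z (h i)))"
      by auto
    have "X (r (h i)) < X (l (h j)) \<and> Y (l (h i)) < Y (r (h j))" if "i < j" "j < n" for i j
    proof -
      have "h i < h j" "h j < N" using h(1,2) that unfolding strict_mono_on_def by auto
      then show ?thesis using sep by blast
    qed
    then have "toothed X Y P n (\<lambda>i. l (h i)) (\<lambda>i. r (h i)) (\<lambda>i. z (h i))"
      unfolding toothed_def using lrz top h(2,3) by auto
    then show "\<exists>l r z. toothed X Y P n l r z" by blast
  qed
qed

section \<open>Oscillations in permutations\<close>

lemma plot_eq_image: "plot xs = (\<lambda>i. (Suc i, xs ! i)) ` {..<length xs}"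
  unfolding plot_def by auto

lemma plot_snoc: "plot (xs @ [a]) = insert (Suc (length xs), a) (plot xs)"
proof -
  have "(\<lambda>i. (Suc i, (xs @ [a]) ! i)) ` {..<length xs} = (\<lambda>i. (Suc i, xs ! i)) ` {..<length xs}"
    by (rule image_cong) (simp_all add: nth_append)
  then show ?thesis by (simp add: plot_eq_image lessThan_Suc)
qed

lemma length_sum21: "length (sum21 k) = 2 * k"
  unfolding sum21_def by (induction k) auto

lemma plot_sum21: "plot (sum21 k) = (\<Union>i<k. {(2 * i + 1, 2 * i + 2), (2 * i + 2, 2 * i + 1)})"
proof (induction k)
  case 0
  then show ?case by (simp add: sum21_def plot_def)
next
  case (Suc k)
  have "sum21 (Suc k) = (sum21 k @ [2 * k + 2]) @ [2 * k + 1]"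
    unfolding sum21_def by simp
  then have "plot (sum21 (Suc k)) = insert (2 * k + 2, 2 * k + 1) (insert (2 * k + 1, 2 * k + 2) (plot (sum21 k)))"
    by (simp only: plot_snoc) (simp add: length_sum21)
  then show ?case using Suc by (simp add: lessThan_Suc insert_commute)
qed

lemma plot_inj:
  assumes "is_perm \<pi>"
  shows "inj_on fst (plot \<pi>)" "inj_on snd (plot \<pi>)"
proof -
  have "distinct \<pi>" using assms unfolding is_perm_def by (auto dest: permutations_of_setD)
  then show "inj_on snd (plot \<pi>)" unfolding plot_def inj_on_def by (auto simp: nth_eq_iff_index_eq)
  show "inj_on fst (plot \<pi>)" unfolding plot_def inj_on_def by auto
qed

lemma finite_plot: "finite (plot \<pi>)"
  by (simp add: plot_eq_image)

lemma fst_plot: "fst ` plot \<pi> = {1..length \<pi>}"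
proof -
  have "fst ` plot \<pi> = Suc ` {..<length \<pi>}" by (simp add: plot_eq_image image_image)
  then show ?thesis by (simp add: lessThan_atLeast0 atLeastLessThanSuc_atLeastAtMost)
qed

lemma snd_plot:
  assumes "is_perm \<pi>"
  shows "snd ` plot \<pi> = {1..length \<pi>}"
proof -
  have "snd ` plot \<pi> = set \<pi>" by (auto simp: plot_eq_image image_image set_conv_nth)
  then show ?thesis using assms unfolding is_perm_def by (auto dest: permutations_of_setD)
qed

definition rank :: "('a \<Rightarrow> nat) \<Rightarrow> 'a set \<Rightarrow> 'a \<Rightarrow> nat" where
  "rank f A p = card {q \<in> A. f q \<le> f p}"

lemma rank_less:
  assumes "finite A" "p \<in> A" "q \<in> A"
  shows "rank f A p < rank f A q \<longleftrightarrow> f p < f q"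
proof
  assume "f p < f q"
  then have "{x \<in> A. f x \<le> f p} \<subseteq> {x \<in> A. f x \<le> f q}" "q \<in> {x \<in> A. f x \<le> f q}"
    "q \<notin> {x \<in> A. f x \<le> f p}" using assms by auto
  then have "{x \<in> A. f x \<le> f p} \<subset> {x \<in> A. f x \<le> f q}" by blast
  then show "rank f A p < rank f A q" unfolding rank_def using assms(1) by (simp add: psubset_card_mono)
next
  assume less: "rank f A p < rank f A q"
  show "f p < f q"
  proof (rule ccontr)
    assume "\<not> f p < f q"
    then have "{x \<in> A. f x \<le> f q} \<subseteq> {x \<in> A. f x \<le> f p}" by auto
    then have "rank f A q \<le> rank f A p" unfolding rank_def using assms(1) by (simp add: card_mono)
    then show False using less by simp
  qed
qed

lemma rank_bij:
  assumes "finite A" "inj_on f A"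
  shows "bij_betw (rank f A) A {1..card A}"
proof -
  have "inj_on (rank f A) A"
    using assms rank_less[OF assms(1)] unfolding inj_on_def by (metis linorder_neq_iff)
  moreover have "rank f A ` A \<subseteq> {1..card A}"
  proof
    fix k assume "k \<in> rank f A ` A"
    then obtain p where p: "p \<in> A" "k = rank f A p" by auto
    have "{q \<in> A. f q \<le> f p} \<noteq> {}" using p by auto
    then have "0 < k" using assms(1) p unfolding rank_def by (simp add: card_gt_0_iff)
    moreover have "k \<le> card A" using assms(1) p unfolding rank_def by (simp add: card_mono)
    ultimately show "k \<in> {1..card A}" by simp
  qed
  ultimately show ?thesis
    unfolding bij_betw_def by (metis card_atLeastAtMost card_image card_subset_eq diff_Suc_1 finite_atLeastAtMost)
qed

text \<open>\<open>pt k\<close> is the \<open>k\<close>-th point from the left, and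
  \<open>\<sigma>\<close> lists the ranks of the heights in this order.\<close>

lemma standardization:
  fixes Q :: "point set"
  assumes "finite Q" "inj_on fst Q" "inj_on snd Q"
  obtains \<sigma> h where "is_perm \<sigma>" "length \<sigma> = card Q" "order_iso h (plot \<sigma>) Q"
proof -
  define pt where "pt k = the_inv_into Q (rank fst Q) k" for k
  define \<sigma> where "\<sigma> = map (\<lambda>i. rank snd Q (pt (Suc i))) [0..<card Q]"
  have rb: "bij_betw (rank fst Q) Q {1..card Q}" "bij_betw (rank snd Q) Q {1..card Q}"
    using rank_bij assms by blast+
  have pt: "bij_betw pt {1..card Q} Q"
    unfolding pt_def using bij_betw_the_inv_into[OF rb(1)] .
  have rpt: "rank fst Q (pt k) = k" if "k \<in> {1..card Q}" for k
    unfolding pt_def using rb(1) that by (simp add: f_the_inv_into_f_bij_betw)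
  have len: "length \<sigma> = card Q" unfolding \<sigma>_def by simp
  have nth: "\<sigma> ! i = rank snd Q (pt (Suc i))" if "i < card Q" for i using that unfolding \<sigma>_def by simp
  have Sb: "bij_betw Suc {..<card Q} {1..card Q}"
    by (rule bij_betwI[of _ _ _ "\<lambda>k. k - 1"]) auto
  have cb: "bij_betw (\<lambda>i. rank snd Q (pt (Suc i))) {..<card Q} {1..card Q}"
    using bij_betw_trans[OF bij_betw_trans[OF Sb pt] rb(2)] by (simp add: comp_def)
  have "set \<sigma> = {1..length \<sigma>}"
    using cb len unfolding \<sigma>_def bij_betw_def by (auto simp: lessThan_atLeast0)
  moreover have "distinct \<sigma>"
    using cb unfolding \<sigma>_def bij_betw_def by (simp add: distinct_map lessThan_atLeast0)
  ultimately have "is_perm \<sigma>" unfolding is_perm_def by auto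
  moreover have "order_iso (\<lambda>p. pt (fst p)) (plot \<sigma>) Q" unfolding order_iso_def
  proof (intro conjI ballI)
    have "bij_betw fst (plot \<sigma>) {1..card Q}"
      using plot_inj(1)[OF \<open>is_perm \<sigma>\<close>] fst_plot[of \<sigma>] len unfolding bij_betw_def by simp
    from bij_betw_trans[OF this pt] show "bij_betw (\<lambda>p. pt (fst p)) (plot \<sigma>) Q" by (simp add: comp_def)
  next
    fix p q assume "p \<in> plot \<sigma>" "q \<in> plot \<sigma>"
    then obtain i j where i: "p = (Suc i, \<sigma> ! i)" "i < card Q" and j: "q = (Suc j, \<sigma> ! j)" "j < card Q"
      using len unfolding plot_def by auto
    have Q: "pt (Suc i) \<in> Q" "pt (Suc j) \<in> Q" using pt i j unfolding bij_betw_def by auto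
    show "fst p < fst q \<longleftrightarrow> fst (pt (fst p)) < fst (pt (fst q))"
      using rank_less[OF assms(1) Q, of fst] rpt[of "Suc i"] rpt[of "Suc j"] i j by simp
    show "snd p < snd q \<longleftrightarrow> snd (pt (fst p)) < snd (pt (fst q))"
      using rank_less[OF assms(1) Q, of snd] nth i j by simp
  qed
  ultimately show ?thesis using that len by blast
qed

abbreviation xc :: "point \<Rightarrow> int" where "xc p \<equiv> int (fst p)"
abbreviation yc :: "point \<Rightarrow> int" where "yc p \<equiv> int (snd p)"

text \<open>The symmetries of the square that preserve inversions: the identity, the reflections in
  both diagonals and the half turn. They account for the four sides on which the monotone sequence
  may lie.\<close>

abbreviation axes :: "(point \<Rightarrow> int) \<Rightarrow> (point \<Rightarrow> int) \<Rightarrow> bool" where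
  "axes X Y \<equiv> (X = xc \<and> Y = yc) \<or> (X = yc \<and> Y = xc) \<or>
     (X = (\<lambda>p. - xc p) \<and> Y = (\<lambda>p. - yc p)) \<or> (X = (\<lambda>p. - yc p) \<and> Y = (\<lambda>p. - xc p))"

text \<open>The map \<open>g\<close> is the inverse of the one in \<open>contains\<close>; it pushes
  sequences of chosen points into the plot of the pattern.\<close>

lemma subpattern:
  assumes \<pi>: "is_perm \<pi>" and Q: "Q \<subseteq> plot \<pi>"
  shows "\<exists>\<sigma> g. is_perm \<sigma> \<and> length \<sigma> = card Q \<and> contains \<pi> \<sigma> \<and> g ` Q = plot \<sigma> \<and>
    (\<forall>p\<in>Q. \<forall>q\<in>Q. fst (g p) < fst (g q) \<longleftrightarrow> fst p < fst q) \<and>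
    (\<forall>p\<in>Q. \<forall>q\<in>Q. snd (g p) < snd (g q) \<longleftrightarrow> snd p < snd q)"
proof -
  have "finite Q" "inj_on fst Q" "inj_on snd Q"
    using plot_inj[OF \<pi>] Q finite_subset[OF Q finite_plot] inj_on_subset by blast+
  then obtain \<sigma> h where \<sigma>: "is_perm \<sigma>" "length \<sigma> = card Q" and h: "order_iso h (plot \<sigma>) Q"
    by (rule standardization)
  define g where "g = the_inv_into (plot \<sigma>) h"
  have b: "bij_betw h (plot \<sigma>) Q" using h unfolding order_iso_def by blast
  then have gb: "bij_betw g Q (plot \<sigma>)" unfolding g_def by (rule bij_betw_the_inv_into)
  have hg: "h (g q) = q" if "q \<in> Q" for q
    unfolding g_def using b that by (simp add: f_the_inv_into_f_bij_betw)
  have gin: "g q \<in> plot \<sigma>" if "q \<in> Q" for q using gb that unfolding bij_betw_def by auto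
  show ?thesis
  proof (intro exI[of _ \<sigma>] exI[of _ g] conjI ballI)
    show "is_perm \<sigma>" "length \<sigma> = card Q" by (fact \<sigma>)+
    show "contains \<pi> \<sigma>" unfolding contains_def using Q h by blast
    show "g ` Q = plot \<sigma>" using gb unfolding bij_betw_def by blast
    show "fst (g p) < fst (g q) \<longleftrightarrow> fst p < fst q" "snd (g p) < snd (g q) \<longleftrightarrow> snd p < snd q"
      if "p \<in> Q" "q \<in> Q" for p q
      using h gin[OF that(1)] gin[OF that(2)] hg[OF that(1)] hg[OF that(2)] unfolding order_iso_def by metis+
  qed
qed

section \<open>Rectangles and pin sequences\<close>

lemma slices_rect:
  assumes "finite S" "S \<noteq> {}"
  shows "slices z (rect S) \<longleftrightarrow>
    (\<exists>s\<in>S. fst s < fst z) \<and> (\<exists>s\<in>S. fst z < fst s) \<and> ((\<forall>s\<in>S. snd z < snd s) \<or> (\<forall>s\<in>S. snd s < snd z)) \<or>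
    (\<exists>s\<in>S. snd s < snd z) \<and> (\<exists>s\<in>S. snd z < snd s) \<and> ((\<forall>s\<in>S. fst z < fst s) \<or> (\<forall>s\<in>S. fst s < fst z))"
  using assms by (cases z) (auto simp: rect_def Min_less_iff Max_gr_iff not_le Min_gr_iff Max_less_iff)

lemma lies_rect:
  assumes "finite S" "S \<noteq> {}"
  shows "lies East z (rect S) \<longleftrightarrow> (\<forall>s\<in>S. fst s < fst z)"
    "lies West z (rect S) \<longleftrightarrow> (\<forall>s\<in>S. fst z < fst s)"
    "lies North z (rect S) \<longleftrightarrow> (\<forall>s\<in>S. snd s < snd z)"
    "lies South z (rect S) \<longleftrightarrow> (\<forall>s\<in>S. snd z < snd s)"
  using assms by (cases z; auto simp: rect_def)+

lemma between_rect:
  assumes "finite S" "S \<noteq> {}"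
  shows "between z (rect S) w \<longleftrightarrow>
    ((\<forall>s\<in>S. fst s < fst z) \<and> fst z < fst w \<or> fst w < fst z \<and> (\<forall>s\<in>S. fst z < fst s)) \<or>
    ((\<forall>s\<in>S. snd s < snd z) \<and> snd z < snd w \<or> snd w < snd z \<and> (\<forall>s\<in>S. snd z < snd s))"
  using assms by (cases z; cases w) (auto simp: rect_def)

lemma at_least_as_extreme_simps:
  "at_least_as_extreme West p q \<longleftrightarrow> fst p \<le> fst q"
  "at_least_as_extreme East p q \<longleftrightarrow> fst q \<le> fst p"
  "at_least_as_extreme South p q \<longleftrightarrow> snd p \<le> snd q"
  "at_least_as_extreme North p q \<longleftrightarrow> snd q \<le> snd p"
  by (cases p; cases q; simp)+

text \<open>A point to the lower right of \<open>p i\<close> is a right pin: \<open>inc\<close>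
  places it to the upper right of all points before \<open>p i\<close>, so its height is between
  those of \<open>p 0\<close> and \<open>p i\<close>. It is extreme because points from index
  \<open>i + 3\<close> on lie to the upper right of the rectangle and do not slice it, while the
  point at \<open>i + 2\<close> stays further left by \<open>nxt\<close>.\<close>

lemma turn_East:
  fixes p :: "nat \<Rightarrow> point"
  assumes inc: "\<And>i j. i + 2 \<le> j \<Longrightarrow> j < n \<Longrightarrow> fst (p i) < fst (p j) \<and> snd (p i) < snd (p j)"
    and dec: "fst (p i) < fst (p (Suc i))" "snd (p (Suc i)) < snd (p i)"
    and nxt: "Suc (Suc i) < n \<Longrightarrow> fst (p (Suc (Suc i))) < fst (p (Suc i))"
    and i: "1 \<le> i" "Suc i < n"
    and S: "S = p ` {..i}" and S': "S' = p ` {..<i}"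
  shows "slices (p (Suc i)) (rect S)" "lies East (p (Suc i)) (rect S)"
    "lies D (p (Suc i)) (rect S) \<Longrightarrow> k < n \<Longrightarrow> slices (p k) (rect S) \<Longrightarrow>
      at_least_as_extreme D (p (Suc i)) (p k)"
    "between (p (Suc i)) (rect S') (p i)"
proof -
  have S0: "finite S" "S \<noteq> {}" "finite S'" "S' \<noteq> {}" using i unfolding S S' by (auto simp: lessThan_empty_iff)
  have old: "fst (p j) < fst (p (Suc i))" "j < i \<Longrightarrow> snd (p j) < snd (p (Suc i))" if "j \<le> i" for j
    using inc[of j "Suc i"] dec that i by (cases "j = i"; simp)+
  have p0: "p 0 \<in> S" "p i \<in> S" "p 0 \<in> S'" using i unfolding S S' by auto
  have low: "snd (p 0) < snd (p (Suc i))" using old(2)[of 0] i by simp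
  have E: "\<forall>s\<in>S. fst s < fst (p (Suc i))" using old(1) unfolding S by auto
  show "slices (p (Suc i)) (rect S)"
    unfolding slices_rect[OF S0(1,2)] using p0 low dec E by blast
  show "lies East (p (Suc i)) (rect S)" unfolding lies_rect[OF S0(1,2)] by (rule E)
  show "between (p (Suc i)) (rect S') (p i)"
    unfolding between_rect[OF S0(3,4)] using old dec(2) unfolding S' by auto
  show "at_least_as_extreme D (p (Suc i)) (p k)"
    if D: "lies D (p (Suc i)) (rect S)" and k: "k < n" and z: "slices (p k) (rect S)"
  proof -
    have DE: "D = East"
    proof -
      have "\<not> lies North (p (Suc i)) (rect S)" "\<not> lies South (p (Suc i)) (rect S)"
        "\<not> lies West (p (Suc i)) (rect S)"
        unfolding lies_rect[OF S0(1,2)] using p0 low dec(2) E by (meson less_asym)+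
      then show ?thesis using D by (cases D) auto
    qed
    consider "k \<le> i" | "k = Suc i" | "k = Suc (Suc i)" | "i + 3 \<le> k" by linarith
    then have "fst (p k) \<le> fst (p (Suc i))"
    proof cases
      case 4
      then have "\<forall>s\<in>S. fst s < fst (p k) \<and> snd s < snd (p k)" using inc k unfolding S by auto
      then have False using z unfolding slices_rect[OF S0(1,2)] by fastforce
      then show ?thesis by simp
    qed (use old(1)[of k] nxt k in auto)
    then show ?thesis unfolding DE at_least_as_extreme_simps .
  qed
qed

text \<open>The mirror image of \<open>turn_East\<close> in the diagonal.\<close>

lemma turn_North:
  fixes p :: "nat \<Rightarrow> point"
  assumes inc: "\<And>i j. i + 2 \<le> j \<Longrightarrow> j < n \<Longrightarrow> fst (p i) < fst (p j) \<and> snd (p i) < snd (p j)"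
    and dec: "snd (p i) < snd (p (Suc i))" "fst (p (Suc i)) < fst (p i)"
    and nxt: "Suc (Suc i) < n \<Longrightarrow> snd (p (Suc (Suc i))) < snd (p (Suc i))"
    and i: "1 \<le> i" "Suc i < n"
    and S: "S = p ` {..i}" and S': "S' = p ` {..<i}"
  shows "slices (p (Suc i)) (rect S)" "lies North (p (Suc i)) (rect S)"
    "lies D (p (Suc i)) (rect S) \<Longrightarrow> k < n \<Longrightarrow> slices (p k) (rect S) \<Longrightarrow>
      at_least_as_extreme D (p (Suc i)) (p k)"
    "between (p (Suc i)) (rect S') (p i)"
proof -
  have S0: "finite S" "S \<noteq> {}" "finite S'" "S' \<noteq> {}" using i unfolding S S' by (auto simp: lessThan_empty_iff)
  have old: "snd (p j) < snd (p (Suc i))" "j < i \<Longrightarrow> fst (p j) < fst (p (Suc i))" if "j \<le> i" for j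
    using inc[of j "Suc i"] dec that i by (cases "j = i"; simp)+
  have p0: "p 0 \<in> S" "p i \<in> S" "p 0 \<in> S'" using i unfolding S S' by auto
  have low: "fst (p 0) < fst (p (Suc i))" using old(2)[of 0] i by simp
  have N: "\<forall>s\<in>S. snd s < snd (p (Suc i))" using old(1) unfolding S by auto
  show "slices (p (Suc i)) (rect S)"
    unfolding slices_rect[OF S0(1,2)] using p0 low dec N by blast
  show "lies North (p (Suc i)) (rect S)" unfolding lies_rect[OF S0(1,2)] by (rule N)
  show "between (p (Suc i)) (rect S') (p i)"
    unfolding between_rect[OF S0(3,4)] using old dec(2) unfolding S' by auto
  show "at_least_as_extreme D (p (Suc i)) (p k)"
    if D: "lies D (p (Suc i)) (rect S)" and k: "k < n" and z: "slices (p k) (rect S)"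
  proof -
    have DN: "D = North"
    proof -
      have "\<not> lies East (p (Suc i)) (rect S)" "\<not> lies West (p (Suc i)) (rect S)"
        "\<not> lies South (p (Suc i)) (rect S)"
        unfolding lies_rect[OF S0(1,2)] using p0 low dec(2) N by (meson less_asym)+
      then show ?thesis using D by (cases D) auto
    qed
    consider "k \<le> i" | "k = Suc i" | "k = Suc (Suc i)" | "i + 3 \<le> k" by linarith
    then have "snd (p k) \<le> snd (p (Suc i))"
    proof cases
      case 4
      then have "\<forall>s\<in>S. fst s < fst (p k) \<and> snd s < snd (p k)" using inc k unfolding S by auto
      then have False using z unfolding slices_rect[OF S0(1,2)] by fastforce
      then show ?thesis by simp
    qed (use old(1)[of k] nxt k in auto)
    then show ?thesis unfolding DN at_least_as_extreme_simps .
  qed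
qed

lemma increasing_oscillation_intro:
  fixes p :: "nat \<Rightarrow> point"
  assumes \<sigma>: "is_perm \<sigma>" "plot \<sigma> = p ` {..<n}" and n: "2 \<le> n"
    and inc: "\<And>i j. i + 2 \<le> j \<Longrightarrow> j < n \<Longrightarrow> fst (p i) < fst (p j) \<and> snd (p i) < snd (p j)"
    and inv: "\<And>i. Suc i < n \<Longrightarrow> fst (p i) < fst (p (Suc i)) \<and> snd (p (Suc i)) < snd (p i) \<or>
      fst (p (Suc i)) < fst (p i) \<and> snd (p i) < snd (p (Suc i))"
  shows "increasing_oscillation \<sigma>"
proof -
  define ps where "ps = map p [0..<n]"
  have len: "length ps = n" and nth: "\<And>i. i < n \<Longrightarrow> ps ! i = p i" unfolding ps_def by auto
  have take: "set (take i ps) = p ` {..<i}" if "i \<le> n" for i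
    using that unfolding ps_def by (auto simp: take_map lessThan_atLeast0)
  have pin: "slices (p i) (rect (p ` {..<i})) \<and>
      (lies East (p i) (rect (p ` {..<i})) \<or> lies North (p i) (rect (p ` {..<i}))) \<and>
      (\<forall>D k. lies D (p i) (rect (p ` {..<i})) \<longrightarrow> k < n \<longrightarrow> slices (p k) (rect (p ` {..<i})) \<longrightarrow>
        at_least_as_extreme D (p i) (p k)) \<and>
      between (p i) (rect (p ` {..<i - 1})) (p (i - 1))" if i: "2 \<le> i" "i < n" for i
  proof -
    obtain m where m: "i = Suc m" "1 \<le> m" "Suc m < n" using i by (cases i) auto
    have S: "p ` {..<i} = p ` {..m}" "p ` {..<i - 1} = p ` {..<m}" using m lessThan_Suc_atMost by auto
    have alt: "fst (p m) < fst (p (Suc (Suc m))) \<and> snd (p m) < snd (p (Suc (Suc m)))" if "Suc (Suc m) < n"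
      using inc[of m "Suc (Suc m)"] that by simp
    from inv[OF m(3)] show ?thesis
    proof
      assume a: "fst (p m) < fst (p (Suc m)) \<and> snd (p (Suc m)) < snd (p m)"
      \<comment> \<open>Directions alternate: a second right turn would put the point at
        \<open>m + 2\<close> below \<open>p m\<close>, against \<open>inc\<close>.\<close>
      have "fst (p (Suc (Suc m))) < fst (p (Suc m))" if "Suc (Suc m) < n"
        using a alt[OF that] inv[OF that] by auto
      from turn_East[OF inc conjunct1[OF a] conjunct2[OF a] this m(2,3) S[unfolded m(1)]]
      show ?thesis unfolding m(1) by simp
    next
      assume a: "fst (p (Suc m)) < fst (p m) \<and> snd (p m) < snd (p (Suc m))"
      have "snd (p (Suc (Suc m))) < snd (p (Suc m))" if "Suc (Suc m) < n"
        using a alt[OF that] inv[OF that] by auto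
      from turn_North[OF inc conjunct2[OF a] conjunct1[OF a] this m(2,3) S[unfolded m(1)]]
      show ?thesis unfolding m(1) by simp
    qed
  qed
  have "proper_pin_sequence \<sigma> ps" unfolding proper_pin_sequence_def
  proof (intro conjI allI impI)
    show "set ps \<subseteq> plot \<sigma>" using take[of n] len \<sigma>(2) by simp
  next
    fix i assume i: "2 \<le> i \<and> i < length ps"
    then have T: "set (take i ps) = p ` {..<i}" "set (take (i - 1) ps) = p ` {..<i - 1}"
      "ps ! i = p i" "ps ! (i - 1) = p (i - 1)" using take len nth by auto
    note pi = pin[of i]
    show "slices (ps ! i) (rect (set (take i ps)))" unfolding T using pi i len by blast
    show "between (ps ! i) (rect (set (take (i - 1) ps))) (ps ! (i - 1))"
      unfolding T using pi i len by blast
    show "\<forall>z\<in>plot \<sigma>. slices z (rect (set (take i ps))) \<longrightarrow> at_least_as_extreme D (ps ! i) z"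
      if "lies D (ps ! i) (rect (set (take i ps)))" for D
      using that pi i len unfolding T \<sigma>(2) by auto
  qed
  moreover have "\<exists>h. order_iso h (plot [2, 1]) {ps ! 0, ps ! 1}"
  proof -
    have pl: "plot [2, 1] = {(1, 2), (2, 1)}"
      by (auto simp: plot_eq_image lessThan_Suc numeral_2_eq_2)
    have two: "ps ! 0 = p 0" "ps ! 1 = p (Suc 0)" using nth n by auto
    from inv[of 0] n consider "fst (p 0) < fst (p (Suc 0))" "snd (p (Suc 0)) < snd (p 0)" |
      "fst (p (Suc 0)) < fst (p 0)" "snd (p 0) < snd (p (Suc 0))" by auto
    then show ?thesis
    proof cases
      case 1
      then show ?thesis unfolding pl two order_iso_def
        by (intro exI[of _ "\<lambda>q. if fst q = 1 then p 0 else p (Suc 0)"]) (auto simp: bij_betw_def inj_on_def)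
    next
      case 2
      then show ?thesis unfolding pl two order_iso_def
        by (intro exI[of _ "\<lambda>q. if fst q = 1 then p (Suc 0) else p 0"]) (auto simp: bij_betw_def inj_on_def)
    qed
  qed
  moreover have "lies East (ps ! i) (rect (set (take i ps))) \<or> lies North (ps ! i) (rect (set (take i ps)))"
    if "2 \<le> i \<and> i < length ps" for i
    using pin[of i] that take[of i] nth[of i] len by auto
  moreover have "set ps = plot \<sigma>" using take[of n] len \<sigma>(2) by simp
  ultimately show ?thesis
    unfolding increasing_oscillation_def using \<sigma>(1) n len by blast
qed

lemma has_osc_contains:
  assumes \<pi>: "is_perm \<pi>" and n: "1 \<le> n" and osc: "has_osc xc yc (plot \<pi>) n"
  shows "\<exists>\<sigma>. increasing_oscillation \<sigma> \<and> length \<sigma> = n \<and> contains \<pi> \<sigma>"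
proof -
  obtain q where q: "\<And>i. i < n \<Longrightarrow> q i \<in> plot \<pi>"
    and inc: "\<And>i j. i + 2 \<le> j \<Longrightarrow> j < n \<Longrightarrow> fst (q i) < fst (q j) \<and> snd (q i) < snd (q j)"
    and inv: "\<And>i. Suc i < n \<Longrightarrow> fst (q i) < fst (q (Suc i)) \<and> snd (q (Suc i)) < snd (q i) \<or>
      fst (q (Suc i)) < fst (q i) \<and> snd (q i) < snd (q (Suc i))"
    using osc unfolding has_osc_def inverted_def by auto
  define Q where "Q = q ` {..<n}"
  have "q i \<noteq> q j" if "i < j" "j < n" for i j
  proof (cases "j = Suc i")
    case True
    then show ?thesis using inv[of i] that by auto
  next
    case False
    then show ?thesis using inc[of i j] that by auto
  qed
  then have "inj_on q {..<n}" unfolding inj_on_def by (metis lessThan_iff linorder_neqE_nat)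
  then have card: "card Q = n" unfolding Q_def by (simp add: card_image)
  have "Q \<subseteq> plot \<pi>" using q unfolding Q_def by auto
  from subpattern[OF \<pi> this] obtain \<sigma> g where \<sigma>: "is_perm \<sigma>" "length \<sigma> = card Q" "contains \<pi> \<sigma>" "g ` Q = plot \<sigma>"
    and g: "\<forall>p\<in>Q. \<forall>q\<in>Q. fst (g p) < fst (g q) \<longleftrightarrow> fst p < fst q"
    "\<forall>p\<in>Q. \<forall>q\<in>Q. snd (g p) < snd (g q) \<longleftrightarrow> snd p < snd q"
    by (elim exE conjE) (rule that)
  have "increasing_oscillation \<sigma>"
  proof (cases "n = 1")
    \<comment> \<open>Length 1 is covered by the convention for oscillations without a copy of
      21.\<close>
    case True
    then have "length \<sigma> = 1" "set \<sigma> = {1}"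
      using \<sigma>(1,2) card unfolding is_perm_def by (auto dest: permutations_of_setD)
    then have "\<sigma> = [1]" by (cases \<sigma>) auto
    then show ?thesis unfolding increasing_oscillation_def by simp
  next
    case False
    have Q: "q i \<in> Q" if "i < n" for i using that unfolding Q_def by simp
    show ?thesis
      by (rule increasing_oscillation_intro[of _ "\<lambda>i. g (q i)" n])
        (use \<sigma> inc inv g Q n False in \<open>auto simp: Q_def image_image\<close>)
  qed
  then show ?thesis using \<sigma> card by auto
qed

section \<open>Sawtooth alternations in permutations\<close>

lemma toothed_less:
  assumes "toothed X Y P n l r z" "i < n" "j < n"
  shows "X (l i) < X (z i)" "X (z i) < X (r i)" "Y (r i) < Y (l i)"
    "i < j \<Longrightarrow> X (r i) < X (l j)" "i < j \<Longrightarrow> Y (l i) < Y (r j)" "Y (l i) < Y (z j)" "Y (r i) < Y (z j)"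
    "i < j \<Longrightarrow> X (z i) < X (z j)"
proof -
  show *: "X (l i) < X (z i)" "X (z i) < X (r i)" "Y (r i) < Y (l i)"
    "i < j \<Longrightarrow> X (r i) < X (l j)" "i < j \<Longrightarrow> Y (l i) < Y (r j)" "Y (l i) < Y (z j)"
    using assms unfolding toothed_def by blast+
  then show "Y (r i) < Y (z j)" by simp
  have "X (l j) < X (z j)" using assms unfolding toothed_def by blast
  then show "i < j \<Longrightarrow> X (z i) < X (z j)" using *(2,4) by simp
qed

lemma toothed_card:
  assumes t: "toothed X Y P n l r z"
  shows "card (l ` {..<n} \<union> r ` {..<n} \<union> z ` {..<n}) = 3 * n"
proof -
  note less = toothed_less[OF t]
  have il: "inj_on l {..<n}"
  proof (rule linorder_inj_onI')
    fix i j assume "i \<in> {..<n}" "j \<in> {..<n}" "i < j"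
    then show "l i \<noteq> l j" using less(1,2,4)[of i j] by auto
  qed
  have ir: "inj_on r {..<n}"
  proof (rule linorder_inj_onI')
    fix i j assume "i \<in> {..<n}" "j \<in> {..<n}" "i < j"
    then show "r i \<noteq> r j" using less(4)[of i j] less(1,2)[of j i] by auto
  qed
  have iz: "inj_on z {..<n}"
  proof (rule linorder_inj_onI')
    fix i j assume "i \<in> {..<n}" "j \<in> {..<n}" "i < j"
    then show "z i \<noteq> z j" using less(8)[of i j] by auto
  qed
  have lr: "l i \<noteq> r j" if "i < n" "j < n" for i j
  proof -
    consider "i < j" | "i = j" | "j < i" by linarith
    then show ?thesis
      using less(4)[of i j] less(4)[of j i] less(1,2)[of i j] less(1,2)[of j i] that by cases auto
  qed
  have lz: "l i \<noteq> z j" "r i \<noteq> z j" if "i < n" "j < n" for i j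
    using less(6,7)[OF that] by auto
  have "l ` {..<n} \<inter> r ` {..<n} = {}" "(l ` {..<n} \<union> r ` {..<n}) \<inter> z ` {..<n} = {}"
    using lr lz by (simp_all add: disjoint_iff) (metis lessThan_iff imageE UnE)+
  then show ?thesis using il ir iz by (simp add: card_Un_disjoint card_image)
qed

lemma toothed_image:
  assumes t: "toothed X Y P n l r z"
    and Q: "l ` {..<n} \<union> r ` {..<n} \<union> z ` {..<n} = Q"
    and g: "\<And>p q. p \<in> Q \<Longrightarrow> q \<in> Q \<Longrightarrow> X (g p) < X (g q) \<longleftrightarrow> X p < X q"
      "\<And>p q. p \<in> Q \<Longrightarrow> q \<in> Q \<Longrightarrow> Y (g p) < Y (g q) \<longleftrightarrow> Y p < Y q"
  shows "toothed X Y (g ` Q) n (\<lambda>i. g (l i)) (\<lambda>i. g (r i)) (\<lambda>i. g (z i))"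
proof -
  have in_Q: "l i \<in> Q" "r i \<in> Q" "z i \<in> Q" if "i < n" for i using Q that by auto
  have "(\<forall>i j. i < j \<longrightarrow> j < n \<longrightarrow> Y (g (z i)) < Y (g (z j))) \<or> (\<forall>i j. i < j \<longrightarrow> j < n \<longrightarrow> Y (g (z j)) < Y (g (z i)))"
    using t unfolding toothed_def by (simp add: g(2) in_Q)
  then show ?thesis unfolding toothed_def using toothed_less[OF t] by (simp add: g in_Q)
qed

lemma sum21_order_iso:
  fixes L R :: "nat \<Rightarrow> point"
  assumes LR: "\<And>i. i < n \<Longrightarrow> fst (L i) < fst (R i) \<and> snd (R i) < snd (L i)"
    and sep: "\<And>i j. i < j \<Longrightarrow> j < n \<Longrightarrow> fst (R i) < fst (L j) \<and> snd (L i) < snd (R j)"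
  shows "\<exists>h. order_iso h (plot (sum21 n)) (L ` {..<n} \<union> R ` {..<n}) \<and>
    (\<forall>i<n. h (2 * i + 1, 2 * i + 2) = L i \<and> h (2 * i + 2, 2 * i + 1) = R i)"
proof -
  \<comment> \<open>Copy \<open>i\<close>, counted from 0, has abscissae \<open>2 * i + 1\<close>
    and \<open>2 * i + 2\<close>; parity tells its upper left point from its lower right
    one.\<close>
  define h where "h p = (if odd (fst p) then L (fst p div 2) else R (fst p div 2 - 1))" for p :: point
  have h: "h (2 * i + 1, 2 * i + 2) = L i" "h (2 * i + 2, 2 * i + 1) = R i" for i
    unfolding h_def by simp_all
  have P: "\<exists>i<n. p = (2 * i + 1, 2 * i + 2) \<or> p = (2 * i + 2, 2 * i + 1)" if "p \<in> plot (sum21 n)" for p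
    using that unfolding plot_sum21 by auto
  have ord: "(fst p < fst q \<longrightarrow> fst (h p) < fst (h q)) \<and> (snd p < snd q \<longrightarrow> snd (h p) < snd (h q))"
    if pq: "p \<in> plot (sum21 n)" "q \<in> plot (sum21 n)" for p q
  proof -
    obtain i j where i: "i < n" "p = (2 * i + 1, 2 * i + 2) \<or> p = (2 * i + 2, 2 * i + 1)"
      and j: "j < n" "q = (2 * j + 1, 2 * j + 2) \<or> q = (2 * j + 2, 2 * j + 1)"
      using P pq by meson
    consider "i < j" | "i = j" | "j < i" by linarith
    then show ?thesis
    proof cases
      case 1
      then have "fst (h p) < fst (h q)" "snd (h p) < snd (h q)"
        using sep[OF 1 j(1)] LR[OF i(1)] LR[OF j(1)] i(2) j(2) h[of i] h[of j] by auto
      then show ?thesis by simp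
    next
      case 2
      then show ?thesis using LR[OF i(1)] i(2) j(2) h[of i] by auto
    next
      case 3
      then show ?thesis using i(2) j(2) by auto
    qed
  qed
  have in_p: "fst p \<noteq> fst q \<and> snd p \<noteq> snd q" if "p \<in> plot (sum21 n)" "q \<in> plot (sum21 n)" "p \<noteq> q" for p q
    using P[OF that(1)] P[OF that(2)] that(3) by (auto; presburger)
  have "inj_on h (plot (sum21 n))"
  proof (rule inj_onI, rule ccontr)
    fix p q assume pq: "p \<in> plot (sum21 n)" "q \<in> plot (sum21 n)" "h p = h q" "p \<noteq> q"
    then have "fst p < fst q \<or> fst q < fst p" using in_p[of p q] by auto
    then show False using ord[of p q] ord[of q p] pq by auto
  qed
  moreover have "h ` plot (sum21 n) = L ` {..<n} \<union> R ` {..<n}"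
    unfolding plot_sum21 image_UN by (auto simp: h[simplified])
  moreover have "(fst p < fst q \<longleftrightarrow> fst (h p) < fst (h q)) \<and> (snd p < snd q \<longleftrightarrow> snd (h p) < snd (h q))"
    if "p \<in> plot (sum21 n)" "q \<in> plot (sum21 n)" for p q
    using ord[OF that] ord[OF that(2,1)] in_p[OF that] by (cases "p = q") fastforce+
  ultimately have "order_iso h (plot (sum21 n)) (L ` {..<n} \<union> R ` {..<n})"
    unfolding order_iso_def bij_betw_def by blast
  then show ?thesis using h by blast
qed

lemma sawtooth_intro:
  fixes L R Z :: "nat \<Rightarrow> point"
  assumes \<sigma>: "is_perm \<sigma>" "length \<sigma> = 3 * n" "plot \<sigma> = L ` {..<n} \<union> R ` {..<n} \<union> Z ` {..<n}"
    and LR: "\<And>i. i < n \<Longrightarrow> fst (L i) < fst (R i) \<and> snd (R i) < snd (L i)"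
    and sep: "\<And>i j. i < j \<Longrightarrow> j < n \<Longrightarrow> fst (R i) < fst (L j) \<and> snd (L i) < snd (R j)"
    and al: "alongside (Z ` {..<n}) (L ` {..<n} \<union> R ` {..<n})"
    and sl: "\<And>i j. i < n \<Longrightarrow> j < n \<Longrightarrow> slices (Z j) (rect {L i, R i}) \<longleftrightarrow> i = j"
    and inj: "inj_on Z {..<n}"
    and mono: "increasing_points (Z ` {..<n}) \<or> decreasing_points (Z ` {..<n})"
  shows "parallel_sawtooth n \<sigma> \<or> wedge_sawtooth n \<sigma>"
proof -
  obtain h where h: "order_iso h (plot (sum21 n)) (L ` {..<n} \<union> R ` {..<n})"
    "\<And>i. i < n \<Longrightarrow> h (2 * i + 1, 2 * i + 2) = L i \<and> h (2 * i + 2, 2 * i + 1) = R i"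
    using sum21_order_iso[of n L R] LR sep by blast
  have "\<exists>!z. z \<in> Z ` {..<n} \<and> slices z (rect (h ` {(2 * i - 1, 2 * i), (2 * i, 2 * i - 1)}))"
    if i: "i \<in> {1..n}" for i
  proof -
    obtain m where m: "i = Suc m" "m < n" using i by (cases i) auto
    have "h ` {(2 * i - 1, 2 * i), (2 * i, 2 * i - 1)} = {L m, R m}"
      using h(2)[OF m(2)] m(1) by simp
    then show ?thesis using sl[OF m(2)] m(2) by (intro ex1I[of _ "Z m"]) auto
  qed
  moreover have "(L ` {..<n} \<union> R ` {..<n}) \<inter> Z ` {..<n} = {}"
    using al unfolding alongside_def by fastforce
  ultimately have "sawtooth_parts n \<sigma> (L ` {..<n} \<union> R ` {..<n}) (Z ` {..<n})"
    unfolding sawtooth_parts_def using \<sigma> al h(1) inj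
    by (intro conjI exI[of _ h] ballI) (simp_all add: card_image)
  then show ?thesis using mono unfolding parallel_sawtooth_def wedge_sawtooth_def by blast
qed

text \<open>All four symmetries map increasing sequences to increasing ones and decreasing sequences
  to decreasing ones.\<close>

lemma monotone_points:
  fixes Z :: "nat \<Rightarrow> point" and X Y :: "point \<Rightarrow> int"
  assumes XY: "axes X Y"
    and X: "\<And>i j. i < j \<Longrightarrow> j < n \<Longrightarrow> X (Z i) < X (Z j)"
    and Y: "(\<forall>i j. i < j \<longrightarrow> j < n \<longrightarrow> Y (Z i) < Y (Z j)) \<or> (\<forall>i j. i < j \<longrightarrow> j < n \<longrightarrow> Y (Z j) < Y (Z i))"
  shows "increasing_points (Z ` {..<n}) \<or> decreasing_points (Z ` {..<n})"
proof -
  have tri: "i < j \<or> i = j \<or> j < i" for i j :: nat by linarith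
  from Y show ?thesis
  proof
    assume Y: "\<forall>i j. i < j \<longrightarrow> j < n \<longrightarrow> Y (Z i) < Y (Z j)"
    have "fst (Z i) < fst (Z j) \<longrightarrow> snd (Z i) < snd (Z j)" if "i < n" "j < n" for i j
      using tri[of i j] XY X[of i j] X[of j i] Y[rule_format, of i j] Y[rule_format, of j i] that by (elim disjE) auto
    then show ?thesis unfolding increasing_points_def by auto
  next
    assume Y: "\<forall>i j. i < j \<longrightarrow> j < n \<longrightarrow> Y (Z j) < Y (Z i)"
    have "fst (Z i) < fst (Z j) \<longrightarrow> snd (Z j) < snd (Z i)" if "i < n" "j < n" for i j
      using tri[of i j] XY X[of i j] X[of j i] Y[rule_format, of i j] Y[rule_format, of j i] that by (elim disjE) auto
    then show ?thesis unfolding decreasing_points_def by auto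
  qed
qed

lemma slices_pair: "slices z (rect {p, q}) \<longleftrightarrow>
    (fst p < fst z \<or> fst q < fst z) \<and> (fst z < fst p \<or> fst z < fst q) \<and>
      (snd z < snd p \<and> snd z < snd q \<or> snd p < snd z \<and> snd q < snd z) \<or>
    (snd p < snd z \<or> snd q < snd z) \<and> (snd z < snd p \<or> snd z < snd q) \<and>
      (fst z < fst p \<and> fst z < fst q \<or> fst p < fst z \<and> fst q < fst z)"
  by (subst slices_rect) auto

text \<open>As \<open>z j\<close> lies above every copy, it slices one only through the abscissa.
  The ranges from \<open>l i\<close> to \<open>r i\<close> are disjoint, so \<open>z j\<close> meets
  just its own.\<close>

lemma toothed_slices:
  assumes t: "toothed X Y P n l r z"
    and XY: "axes X Y"
    and i: "i < n" "j < n"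
  shows "slices (z j) (rect {l i, r i}) \<longleftrightarrow> i = j"
proof -
  note less = toothed_less[OF t]
  have "i = j \<longleftrightarrow> X (l i) < X (z j) \<and> X (z j) < X (r i)"
  proof
    assume "X (l i) < X (z j) \<and> X (z j) < X (r i)"
    then show "i = j"
      using less(4)[of i j] less(4)[of j i] less(1)[of j i] less(2)[of j i] i
      by (cases i j rule: linorder_cases) auto
  qed (use less i in auto)
  moreover have "Y (l i) < Y (z j)" "Y (r i) < Y (z j)" "X (l i) < X (r i)"
    using less(1,2,6,7)[OF i] by auto
  ultimately show ?thesis using XY unfolding slices_pair by (elim disjE) auto
qed

text \<open>The copies have to be listed from lower left to upper right, each with its upper left
  point first. Reflection in the main diagonal exchanges \<open>l\<close> and \<open>r\<close>,
  reflection in the other diagonal reverses the order by \<open>rv\<close>, and the half turn does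
  both.\<close>

lemma toothed_sawtooth:
  assumes t: "toothed X Y (plot \<sigma>) n l r z"
    and XY: "axes X Y"
    and \<sigma>: "is_perm \<sigma>" "length \<sigma> = 3 * n" "plot \<sigma> = l ` {..<n} \<union> r ` {..<n} \<union> z ` {..<n}"
  shows "parallel_sawtooth n \<sigma> \<or> wedge_sawtooth n \<sigma>"
proof -
  note less = toothed_less[OF t]
  define rv where "rv i = n - Suc i" for i
  have rv: "rv i < n" "i < j \<Longrightarrow> j < n \<Longrightarrow> rv j < rv i" if "i < n" for i j
    using that unfolding rv_def by auto
  have rv_inj: "rv i = rv j \<longleftrightarrow> i = j" if "i < n" "j < n" for i j
    using that unfolding rv_def by auto
  have "rv ` {..<n} = {..<n}"
  proof (intro equalityI subsetI)
    fix k assume "k \<in> {..<n}"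
    then have "k = rv (n - Suc k)" "n - Suc k \<in> {..<n}" unfolding rv_def by auto
    then show "k \<in> rv ` {..<n}" by (rule image_eqI)
  qed (use rv in auto)
  have rv_img: "(\<lambda>i. f (rv i)) ` {..<n} = f ` {..<n}" for f :: "nat \<Rightarrow> point"
    by (metis \<open>rv ` {..<n} = {..<n}\<close> image_image)
  have zinj: "inj_on z {..<n}"
  proof (rule linorder_inj_onI')
    fix i j assume "i \<in> {..<n}" "j \<in> {..<n}" "i < j"
    then show "z i \<noteq> z j" using less(8)[of i j] by auto
  qed
  have mono: "increasing_points (z ` {..<n}) \<or> decreasing_points (z ` {..<n})"
    by (rule monotone_points[OF XY]) (use less(8) t in \<open>auto simp: toothed_def\<close>)
  note sl = toothed_slices[OF t XY]
  have al: "alongside (z ` {..<n}) (l ` {..<n} \<union> r ` {..<n})"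
    using XY less(6,7) unfolding alongside_def by (elim disjE) auto
  have al': "alongside (z ` {..<n}) (r ` {..<n} \<union> l ` {..<n})"
    using al by (simp add: Un_commute)
  have sl': "slices (z j) (rect {r i, l i}) \<longleftrightarrow> i = j" if "i < n" "j < n" for i j
    using sl[OF that] by (simp add: insert_commute)
  have A: "X (l i) < X (r i)" "Y (r i) < Y (l i)" if "i < n" for i
    using less(1,2,3)[OF that that] by auto
  have B: "X (r i) < X (l j)" "Y (l i) < Y (r j)" if "i < j" "j < n" for i j
    using less(4,5)[of i j] that by auto
  have zinj': "inj_on (\<lambda>i. z (rv i)) {..<n}"
  proof (rule inj_onI)
    fix i j assume ij: "i \<in> {..<n}" "j \<in> {..<n}" "z (rv i) = z (rv j)"
    then have "rv i = rv j" using inj_onD[OF zinj] rv(1) by simp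
    then show "i = j" using rv_inj ij by simp
  qed
  from XY show ?thesis
  proof (elim disjE conjE)
    assume XY: "X = xc" "Y = yc"
    show ?thesis
      by (rule sawtooth_intro[OF \<sigma> _ _ al sl zinj mono]) (use A B in \<open>auto simp: XY\<close>)
  next
    assume XY: "X = yc" "Y = xc"
    have \<sigma>3: "plot \<sigma> = r ` {..<n} \<union> l ` {..<n} \<union> z ` {..<n}" using \<sigma>(3) by (simp add: Un_commute)
    show ?thesis
      by (rule sawtooth_intro[OF \<sigma>(1,2) \<sigma>3 _ _ al' sl' zinj mono]) (use A B in \<open>auto simp: XY\<close>)
  next
    assume XY: "X = (\<lambda>p. - xc p)" "Y = (\<lambda>p. - yc p)"
    show ?thesis
      by (rule sawtooth_intro[of \<sigma> n "\<lambda>i. r (rv i)" "\<lambda>i. l (rv i)" "\<lambda>i. z (rv i)", unfolded rv_img,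
            OF \<sigma>(1,2) _ _ _ al' _ zinj' mono])
        (use \<sigma>(3) A B rv rv_inj sl' in \<open>auto simp: XY Un_commute\<close>)
  next
    assume XY: "X = (\<lambda>p. - yc p)" "Y = (\<lambda>p. - xc p)"
    show ?thesis
      by (rule sawtooth_intro[of \<sigma> n "\<lambda>i. l (rv i)" "\<lambda>i. r (rv i)" "\<lambda>i. z (rv i)", unfolded rv_img,
            OF \<sigma> _ _ al _ zinj' mono])
        (use A B rv rv_inj sl in \<open>auto simp: XY\<close>)
  qed
qed

lemma toothed_contains:
  assumes \<pi>: "is_perm \<pi>" and t: "toothed X Y (plot \<pi>) n l r z"
    and XY: "axes X Y"
  shows "\<exists>\<sigma>. (parallel_sawtooth n \<sigma> \<or> wedge_sawtooth n \<sigma>) \<and> contains \<pi> \<sigma>"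
proof -
  define Q where "Q = l ` {..<n} \<union> r ` {..<n} \<union> z ` {..<n}"
  have "Q \<subseteq> plot \<pi>" using t unfolding Q_def toothed_def by auto
  from subpattern[OF \<pi> this] obtain \<sigma> g where
    \<sigma>: "is_perm \<sigma>" "length \<sigma> = card Q" "contains \<pi> \<sigma>" "g ` Q = plot \<sigma>"
    and g: "\<forall>p\<in>Q. \<forall>q\<in>Q. fst (g p) < fst (g q) \<longleftrightarrow> fst p < fst q"
    "\<forall>p\<in>Q. \<forall>q\<in>Q. snd (g p) < snd (g q) \<longleftrightarrow> snd p < snd q"
    by (elim exE conjE) (rule that)
  have gX: "X (g p) < X (g q) \<longleftrightarrow> X p < X q" "Y (g p) < Y (g q) \<longleftrightarrow> Y p < Y q" if "p \<in> Q" "q \<in> Q" for p q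
    using XY g that by (elim disjE conjE; simp)+
  have "toothed X Y (plot \<sigma>) n (\<lambda>i. g (l i)) (\<lambda>i. g (r i)) (\<lambda>i. g (z i))"
    using toothed_image[OF t Q_def[symmetric] gX] \<sigma>(4) by simp
  moreover have "length \<sigma> = 3 * n" using \<sigma>(2) toothed_card[OF t] unfolding Q_def by simp
  moreover have "plot \<sigma> = (\<lambda>i. g (l i)) ` {..<n} \<union> (\<lambda>i. g (r i)) ` {..<n} \<union> (\<lambda>i. g (z i)) ` {..<n}"
    using \<sigma>(4) unfolding Q_def by (simp add: image_Un image_image)
  ultimately have "parallel_sawtooth n \<sigma> \<or> wedge_sawtooth n \<sigma>"
    by (intro toothed_sawtooth[of X Y \<sigma> n "\<lambda>i. g (l i)" "\<lambda>i. g (r i)" "\<lambda>i. g (z i)"] XY \<sigma>(1))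
  then show ?thesis using \<sigma>(3) by (intro exI[of _ \<sigma>] conjI)
qed

section \<open>Slicing points in simple permutations\<close>

lemma unsliced_consecutive:
  fixes f :: "point \<Rightarrow> nat"
  assumes "finite S" "S \<noteq> {}" "\<And>k. Min (f ` S) < k \<Longrightarrow> k < Max (f ` S) \<Longrightarrow> k \<in> f ` S"
  shows "consecutive (f ` S)"
proof -
  have "f ` S = {Min (f ` S)..Max (f ` S)}"
  proof (intro equalityI subsetI)
    fix k assume k: "k \<in> {Min (f ` S)..Max (f ` S)}"
    have "Min (f ` S) \<in> f ` S" "Max (f ` S) \<in> f ` S" using assms(1,2) by auto
    then show "k \<in> f ` S" using k assms(3)[of k] by (cases "k = Min (f ` S)"; cases "k = Max (f ` S)") auto
  qed (use assms(1) in auto)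
  then show ?thesis unfolding consecutive_def by blast
qed

text \<open>Let \<open>S\<close> consist of all points in the bounding box of \<open>D\<close>. It
  has two points and misses the one to the lower left, so it is not an interval. Some row or column
  through the interior of the box thus has its point outside the box, and that point slices
  \<open>D\<close>.\<close>

lemma simple_slicer_closed:
  assumes "simple \<pi>"
  shows "slicer_closed xc yc (plot \<pi>)"
  unfolding slicer_closed_def
proof (intro allI impI)
  fix D assume D: "D \<subseteq> plot \<pi>" and two: "\<exists>a\<in>D. \<exists>b\<in>D. a \<noteq> b"
    and low: "\<exists>p\<in>plot \<pi>. \<forall>d\<in>D. xc p < xc d \<and> yc p < yc d"
  have \<pi>: "is_perm \<pi>" using assms unfolding simple_def by blast
  have fD: "finite D" "D \<noteq> {}" using D finite_plot finite_subset two by auto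
  define a b c d where "a = Min (fst ` D)" and "b = Max (fst ` D)" and "c = Min (snd ` D)" and "d = Max (snd ` D)"
  define S where "S = {p \<in> plot \<pi>. a \<le> fst p \<and> fst p \<le> b \<and> c \<le> snd p \<and> snd p \<le> d}"
  have "a \<le> fst p \<and> fst p \<le> b \<and> c \<le> snd p \<and> snd p \<le> d" if "p \<in> D" for p
    unfolding a_def b_def c_def d_def using fD(1) that by (intro conjI Min_le Max_ge) auto
  then have DS: "D \<subseteq> S" using D unfolding S_def by blast
  have fS: "finite S" "S \<noteq> {}" using finite_plot DS fD unfolding S_def by auto
  have mm: "a \<in> fst ` D" "b \<in> fst ` D" "c \<in> snd ` D" "d \<in> snd ` D"
    using fD unfolding a_def b_def c_def d_def by auto
  have MS: "Min (fst ` S) = a" "Max (fst ` S) = b" "Min (snd ` S) = c" "Max (snd ` S) = d"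
    using fS mm DS by (auto intro!: Min_eqI Max_eqI simp: S_def)
  obtain p where p: "p \<in> plot \<pi>" "\<forall>d\<in>D. xc p < xc d \<and> yc p < yc d" using low by blast
  then have "p \<notin> S" using mm(1) unfolding S_def by fastforce
  then have "S \<noteq> plot \<pi>" using p(1) by auto
  moreover have "\<not> (\<exists>q. S = {q})" using two DS by blast
  ultimately have "\<not> perm_interval \<pi> S" using assms unfolding simple_def by blast
  then have "\<not> consecutive (fst ` S) \<or> \<not> consecutive (snd ` S)"
    unfolding perm_interval_def using fS(2) unfolding S_def by blast
  then have "\<exists>z\<in>plot \<pi>. (a < fst z \<and> fst z < b \<and> (snd z < c \<or> d < snd z)) \<or>
      (c < snd z \<and> snd z < d \<and> (fst z < a \<or> b < fst z))"
  proof
    assume "\<not> consecutive (fst ` S)"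
    then obtain k where k: "a < k" "k < b" "k \<notin> fst ` S"
      using unsliced_consecutive[OF fS, of fst] MS by auto
    have "a \<in> fst ` plot \<pi>" "b \<in> fst ` plot \<pi>" using mm D by blast+
    then have "k \<in> fst ` plot \<pi>" using k(1,2) unfolding fst_plot by simp
    then show ?thesis using k unfolding S_def by force
  next
    assume "\<not> consecutive (snd ` S)"
    then obtain k where k: "c < k" "k < d" "k \<notin> snd ` S"
      using unsliced_consecutive[OF fS, of snd] MS by auto
    have "c \<in> snd ` plot \<pi>" "d \<in> snd ` plot \<pi>" using mm D by blast+
    then have "k \<in> snd ` plot \<pi>" using k(1,2) unfolding snd_plot[OF \<pi>] by simp
    then show ?thesis using k unfolding S_def by force
  qed
  then obtain z where z: "z \<in> plot \<pi>" "(a < fst z \<and> fst z < b \<and> (snd z < c \<or> d < snd z)) \<or>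
      (c < snd z \<and> snd z < d \<and> (fst z < a \<or> b < fst z))" by blast
  have le: "a \<le> fst q" "fst q \<le> b" "c \<le> snd q" "snd q \<le> d" if "q \<in> D" for q
    using DS that unfolding S_def by auto
  obtain qa qb qc qd where q: "qa \<in> D" "fst qa = a" "qb \<in> D" "fst qb = b" "qc \<in> D" "snd qc = c"
    "qd \<in> D" "snd qd = d" using mm by (elim imageE) (metis that)
  have ex: "a < fst z \<Longrightarrow> \<exists>q\<in>D. fst q < fst z" "fst z < b \<Longrightarrow> \<exists>q\<in>D. fst z < fst q"
    "c < snd z \<Longrightarrow> \<exists>q\<in>D. snd q < snd z" "snd z < d \<Longrightarrow> \<exists>q\<in>D. snd z < snd q"
    using q by metis+
  have all: "fst z < a \<Longrightarrow> \<forall>q\<in>D. fst z < fst q" "b < fst z \<Longrightarrow> \<forall>q\<in>D. fst q < fst z"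
    "snd z < c \<Longrightarrow> \<forall>q\<in>D. snd z < snd q" "d < snd z \<Longrightarrow> \<forall>q\<in>D. snd q < snd z"
    using le by (meson less_le_trans le_less_trans)+
  have "caps xc yc D z \<or> caps yc xc D z \<or> caps (\<lambda>p. - xc p) (\<lambda>p. - yc p) D z \<or>
      caps (\<lambda>p. - yc p) (\<lambda>p. - xc p) D z"
    using z(2) ex all unfolding caps_def by (elim disjE conjE) simp_all
  then show "\<exists>z\<in>plot \<pi>. caps xc yc D z \<or> caps yc xc D z \<or> caps (\<lambda>p. - xc p) (\<lambda>p. - yc p) D z \<or>
      caps (\<lambda>p. - yc p) (\<lambda>p. - xc p) D z" using z(1) by blast
qed

lemma contains_sum21_chain:
  assumes "contains \<pi> (sum21 (Suc k))"
  obtains C where "chain xc yc C k" "\<And>i. i \<le> k \<Longrightarrow> C i \<subseteq> plot \<pi>"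
proof -
  obtain Q h where Q: "Q \<subseteq> plot \<pi>" and h: "order_iso h (plot (sum21 (Suc k))) Q"
    using assms unfolding contains_def by blast
  define C where "C i = {h (2 * i + 1, 2 * i + 2), h (2 * i + 2, 2 * i + 1)}" for i
  have P: "(2 * i + 1, 2 * i + 2) \<in> plot (sum21 (Suc k))" "(2 * i + 2, 2 * i + 1) \<in> plot (sum21 (Suc k))"
    if "i \<le> k" for i
    using that unfolding plot_sum21 by auto
  have ord: "fst (h p) < fst (h q) \<longleftrightarrow> fst p < fst q" "snd (h p) < snd (h q) \<longleftrightarrow> snd p < snd q"
    if "p \<in> plot (sum21 (Suc k))" "q \<in> plot (sum21 (Suc k))" for p q
    using h that unfolding order_iso_def by auto
  have "chain xc yc C k" unfolding chain_def
  proof (intro conjI allI impI ballI)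
    fix i assume "i \<le> k"
    then show "\<exists>a b. C i = {a, b} \<and> inverted xc yc a b"
      unfolding C_def inverted_def using ord[OF P(1)[of i] P(2)[of i]] ord[OF P(2)[of i] P(1)[of i]]
      by (intro exI[of _ "h (2 * i + 1, 2 * i + 2)"] exI[of _ "h (2 * i + 2, 2 * i + 1)"]) simp
  next
    fix i j c d assume ij: "i < j" "j \<le> k" and "c \<in> C i" "d \<in> C j"
    then obtain p q where "c = h p" "d = h q" "p = (2 * i + 1, 2 * i + 2) \<or> p = (2 * i + 2, 2 * i + 1)"
      "q = (2 * j + 1, 2 * j + 2) \<or> q = (2 * j + 2, 2 * j + 1)" unfolding C_def by auto
    moreover have "p \<in> plot (sum21 (Suc k))" "q \<in> plot (sum21 (Suc k))"
      using calculation P[of i] P[of j] ij by auto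
    ultimately show "xc c < xc d" "yc c < yc d" using ord[of p q] ij by auto
  qed
  moreover have "C i \<subseteq> plot \<pi>" if "i \<le> k" for i
    using h Q P[OF that] unfolding C_def order_iso_def bij_betw_def by auto
  ultimately show ?thesis by (rule that)
qed

section \<open>The main theorem\<close>

lemma saw_cong:
  assumes "saw X Y P C M" "\<And>i. i \<le> M \<Longrightarrow> C i = C' i"
  shows "saw X Y P C' M"
  using assms(1) assms(2)[of 0] assms(2)[of "M - 2"] assms(2)[of "M - 1"] unfolding saw_def by simp

lemma jump_cong:
  assumes "jump X Y P C M j" "Suc j < M" "\<And>i. i \<le> M \<Longrightarrow> C i = C' i"
  shows "jump X Y P C' M j"
  using assms(1,2) assms(3)[of 0] assms(3)[of M] assms(3)[of j] assms(3)[of "Suc j"]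
  unfolding jump_def by simp

text \<open>Provides the condition of \<open>ramsey_increasing\<close> that a colour depends on the
  first \<open>M + 1\<close> values only.\<close>

lemma outcome_cong:
  assumes "outcome X Y P M \<xi> C" "\<And>i. i \<le> M \<Longrightarrow> C i = C' i"
  shows "outcome X Y P M \<xi> C'"
proof -
  have r: "C (M - i) = C' (M - i)" for i using assms(2) by simp
  show ?thesis
    using assms(1) saw_cong[of _ _ P C M C', OF _ assms(2)] jump_cong[of _ _ P C M _ C', OF _ _ assms(2)]
    unfolding outcome_def r by (auto split: if_splits)
qed

text \<open>The half turn reverses every subchain separately, whereas \<open>saw_homogeneous\<close>
  takes subchains of one reversed chain. The substitution \<open>s' i = K - s (M - i)\<close>
  reconciles the two.\<close>

lemma saw_homogeneous_neg:
  fixes K M :: nat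
  assumes S: "\<forall>s. strict_mono_on {..M} s \<longrightarrow> (\<forall>i\<le>M. s i \<le> K) \<longrightarrow> saw X Y P (\<lambda>i. D (s (M - i))) M"
  shows "\<forall>s. strict_mono_on {..M} s \<longrightarrow> (\<forall>i\<le>M. s i \<le> K) \<longrightarrow> saw X Y P (\<lambda>i. D (K - s i)) M"
proof (intro allI impI)
  fix s assume s: "strict_mono_on {..M} s" "\<forall>i\<le>M. s i \<le> K"
  define s' where "s' i = K - s (M - i)" for i
  have "s' i < s' j" if "i < j" "j \<le> M" for i j
  proof -
    have "s (M - j) < s (M - i)" "s (M - i) \<le> K" using s that unfolding strict_mono_on_def by auto
    then show ?thesis unfolding s'_def by (intro diff_less_mono2) auto
  qed
  then have "strict_mono_on {..M} s'" "\<forall>i\<le>M. s' i \<le> K" unfolding strict_mono_on_def s'_def by auto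
  then have "saw X Y P (\<lambda>i. D (s' (M - i))) M" using S by blast
  then show "saw X Y P (\<lambda>i. D (K - s i)) M" by (rule saw_cong) (simp add: s'_def)
qed

theorem theorem1p3:
  "\<exists>f :: nat \<Rightarrow> nat. \<forall>n :: nat. \<forall>\<pi> :: nat list.
     simple \<pi> \<and> contains \<pi> (sum21 (f n)) \<longrightarrow>
       (\<exists>\<sigma>. (parallel_sawtooth n \<sigma> \<or> wedge_sawtooth n \<sigma>) \<and> contains \<pi> \<sigma>) \<or>
       (\<exists>\<sigma>. increasing_oscillation \<sigma> \<and> length \<sigma> = n \<and> contains \<pi> \<sigma>)"
proof (rule choice, rule allI)
  fix n :: nat
  define M where "M = 20 + 4 * n"
  obtain N0 :: nat where N0: "\<forall>(X :: point \<Rightarrow> int) Y P C K M. chain X Y C K \<longrightarrow> inj_on Y P \<longrightarrow>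
      (\<forall>s. strict_mono_on {..M} s \<longrightarrow> (\<forall>i\<le>M. s i \<le> K) \<longrightarrow> saw X Y P (\<lambda>i. C (s i)) M) \<longrightarrow>
      2 \<le> M \<longrightarrow> (N0 + 1) * (M + 1) \<le> K \<longrightarrow> (\<exists>l r z. toothed X Y P n l r z)"
    using saw_homogeneous[of n] by (elim exE) (rule that)
  \<comment> \<open>Long enough for homogeneous saws as well as for homogeneous jumps.\<close>
  define K where "K = (N0 + 1) * (M + 1) + (n + 3) * (M + 1)"
  obtain N :: nat where N: "\<forall>R :: nat \<Rightarrow> (nat \<Rightarrow> nat) \<Rightarrow> bool.
    (\<forall>\<xi> s t. R \<xi> s \<longrightarrow> (\<forall>i<Suc M. s i = t i) \<longrightarrow> R \<xi> t) \<longrightarrow>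
    (\<forall>t. strict_mono_on {..<Suc M} t \<longrightarrow> (\<forall>i<Suc M. t i < N) \<longrightarrow> (\<exists>\<xi><4 + 2 * M. R \<xi> t)) \<longrightarrow>
    (\<exists>\<xi><4 + 2 * M. \<exists>h. strict_mono_on {..<Suc K} h \<and> (\<forall>i<Suc K. h i < N) \<and>
      (\<forall>s. strict_mono_on {..<Suc M} s \<longrightarrow> (\<forall>i<Suc M. s i < Suc K) \<longrightarrow> R \<xi> (\<lambda>i. h (s i))))"
    using ramsey_increasing[of "Suc M" "4 + 2 * M" "Suc K"] by (elim exE) (rule that)
  have main: "(\<exists>\<sigma>. (parallel_sawtooth n \<sigma> \<or> wedge_sawtooth n \<sigma>) \<and> contains \<pi> \<sigma>) \<or>
      (\<exists>\<sigma>. increasing_oscillation \<sigma> \<and> length \<sigma> = n \<and> contains \<pi> \<sigma>)"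
    if simple: "simple \<pi>" and cont: "contains \<pi> (sum21 (Suc N))" for \<pi>
  proof -
    have \<pi>: "is_perm \<pi>" using simple unfolding simple_def by blast
    define P where "P = plot \<pi>"
    have toothed: ?thesis if "toothed X Y P n l r z"
      "axes X Y" for X Y l r z
      using toothed_contains[OF \<pi> that(1)[unfolded P_def] that(2)] by (rule disjI1)
    show ?thesis
    proof (cases "has_osc xc yc P n")
      case True
      show ?thesis
      proof (cases "n = 0")
        case True
        \<comment> \<open>\<open>has_osc\<close> holds trivially for \<open>n = 0\<close>, where the
          empty sawtooth alternation serves; there is no index at which the sequences would be
          evaluated.\<close>
        have "toothed xc yc P n undefined undefined undefined" unfolding toothed_def True by simp
        then show ?thesis by (rule toothed) simp
      next
        case False
        then show ?thesis using has_osc_contains[OF \<pi>, of n] \<open>has_osc xc yc P n\<close> unfolding P_def by simp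
      qed
    next
      case no_osc: False
      obtain C where C: "chain xc yc C N" "\<And>i. i \<le> N \<Longrightarrow> C i \<subseteq> P"
        using contains_sum21_chain[OF cont] unfolding P_def by metis
      have fin: "finite P" unfolding P_def by (rule finite_plot)
      have inj: "inj_on xc P" "inj_on yc P"
        using plot_inj[OF \<pi>] unfolding P_def inj_on_def by auto
      have ninj: "inj_on (\<lambda>p. - xc p) P" "inj_on (\<lambda>p. - yc p) P"
        using inj unfolding inj_on_def by auto
      \<comment> \<open>A sequence of indices is coloured by the outcomes of the subchain that it
        selects.\<close>
      define R where "R \<xi> t \<longleftrightarrow> outcome xc yc P M \<xi> (\<lambda>i. C (t i))" for \<xi> and t :: "nat \<Rightarrow> nat"
      have "R \<xi> t" if "R \<xi> s" "\<forall>i<Suc M. s i = t i" for \<xi> s t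
        using that unfolding R_def by (elim outcome_cong) auto
      moreover have "\<exists>\<xi><4 + 2 * M. R \<xi> t" if t: "strict_mono_on {..<Suc M} t" "\<forall>i<Suc M. t i < N" for t
      proof -
        have "chain xc yc (\<lambda>i. C (t i)) M"
          by (rule chain_subseq[OF C(1)]) (use t in \<open>auto simp: lessThan_Suc_atMost less_Suc_eq_le less_imp_le\<close>)
        moreover have "C (t i) \<subseteq> P" if "i \<le> M" for i using C(2) t(2) that by (simp add: less_imp_le)
        ultimately show ?thesis
          using chain_outcome[OF _ _ fin inj _ M_def] simple_slicer_closed[OF simple] no_osc
          unfolding R_def P_def by blast
      qed
      ultimately obtain \<xi> h where h: "strict_mono_on {..K} h" "\<forall>i\<le>K. h i < N"
        and hom: "\<And>s. strict_mono_on {..M} s \<Longrightarrow> \<forall>i\<le>M. s i \<le> K \<Longrightarrow> R \<xi> (\<lambda>i. h (s i))"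
        using N[rule_format, of R] by (auto simp: lessThan_Suc_atMost less_Suc_eq_le)
      define D where "D i = C (h i)" for i
      have ch: "chain xc yc D K"
        unfolding D_def by (rule chain_subseq[OF C(1) h(1)]) (use h(2) in \<open>simp add: less_imp_le\<close>)
      have DP: "D i \<subseteq> P" if "i \<le> K" for i unfolding D_def using C(2) h(2) that by (simp add: less_imp_le)
      have out: "outcome xc yc P M \<xi> (\<lambda>i. D (s i))" if "strict_mono_on {..M} s" "\<forall>i\<le>M. s i \<le> K" for s
        using hom[OF that] unfolding R_def D_def .
      have M2: "2 \<le> M" and K: "(N0 + 1) * (M + 1) \<le> K" "(n + 3) * (M + 1) \<le> K"
        unfolding M_def K_def by auto
      have "M + 1 \<le> (n + 3) * (M + 1)" by (simp add: add_mult_distrib)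
      then have MK: "M \<le> K" using K(2) by linarith
      have saw: ?thesis
        if XY: "axes X Y"
          and E: "chain X Y E K" "inj_on Y P"
            "\<forall>s. strict_mono_on {..M} s \<longrightarrow> (\<forall>i\<le>M. s i \<le> K) \<longrightarrow> saw X Y P (\<lambda>i. E (s i)) M"
        for X Y and E
      proof -
        obtain l r z where "toothed X Y P n l r z" using N0 E M2 K(1) by blast
        then show ?thesis by (rule toothed[OF _ XY])
      qed
      consider "\<xi> = 0" | "\<xi> = 1" | "\<xi> = 2" | "\<xi> = 3" | "4 \<le> \<xi>" "\<xi> < 4 + M" | "4 + M \<le> \<xi>" by linarith
      then show ?thesis
      proof cases
        case 1
        show ?thesis
          by (rule saw[of xc yc D, OF _ ch inj(2)]) (use out 1 in \<open>auto simp: outcome_def\<close>)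
      next
        case 2
        show ?thesis
          by (rule saw[of yc xc D, OF _ chain_swap[OF ch] inj(1)]) (use out 2 in \<open>auto simp: outcome_def\<close>)
      next
        case 3
        show ?thesis
          by (rule saw[OF _ chain_neg[OF ch] ninj(2) saw_homogeneous_neg])
            (use out 3 in \<open>auto simp: outcome_def\<close>)
      next
        case 4
        show ?thesis
          by (rule saw[OF _ chain_neg[OF chain_swap[OF ch]] ninj(1) saw_homogeneous_neg])
            (use out 4 in \<open>auto simp: outcome_def\<close>)
      next
        case 5
        then have J: "Suc (\<xi> - 4) < M \<and> jump xc yc P (\<lambda>i. D (s i)) M (\<xi> - 4)"
          if "strict_mono_on {..M} s" "\<forall>i\<le>M. s i \<le> K" for s
          using out[OF that] unfolding outcome_def by simp
        \<comment> \<open>One subchain, here the first \<open>M + 1\<close> copies, suffices to see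
          that the jump index of this colour is admissible.\<close>
        have "strict_mono_on {..M} (\<lambda>i. i)" "\<forall>i\<le>M. i \<le> K"
          using MK by (auto simp: strict_mono_on_def)
        then have "Suc (\<xi> - 4) < M" using J by blast
        then have "has_osc xc yc P n"
          by (intro jump_homogeneous[OF ch DP _ _ K(2)]) (use J in auto)
        then show ?thesis using no_osc by simp
      next
        case 6
        then have J: "Suc (\<xi> - 4 - M) < M \<and> jump yc xc P (\<lambda>i. D (s i)) M (\<xi> - 4 - M)"
          if "strict_mono_on {..M} s" "\<forall>i\<le>M. s i \<le> K" for s
          using out[OF that] M2 unfolding outcome_def by simp
        have "strict_mono_on {..M} (\<lambda>i. i)" "\<forall>i\<le>M. i \<le> K"
          using MK by (auto simp: strict_mono_on_def)
        then have "Suc (\<xi> - 4 - M) < M" using J by blast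
        then have "has_osc yc xc P n"
          by (intro jump_homogeneous[OF chain_swap[OF ch] DP _ _ K(2)]) (use J in auto)
        then show ?thesis using no_osc has_osc_swap by blast
      qed
    qed
  qed
  show "\<exists>k. \<forall>\<pi>. simple \<pi> \<and> contains \<pi> (sum21 k) \<longrightarrow>
       (\<exists>\<sigma>. (parallel_sawtooth n \<sigma> \<or> wedge_sawtooth n \<sigma>) \<and> contains \<pi> \<sigma>) \<or>
       (\<exists>\<sigma>. increasing_oscillation \<sigma> \<and> length \<sigma> = n \<and> contains \<pi> \<sigma>)"
    \<comment> \<open>The copies are indexed from 0 to \<open>N\<close>, hence \<open>Suc N\<close>
      of them.\<close>
    using main by (intro exI[of _ "Suc N"]) blast
qed

end
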